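(* For $n\ge 3$, the supercentralizer $SZ(\mathfrak A_n,\mathfrak A_{n-2})$ is generated by the supercenter $SZ(\mathfrak A_{n-2})$ and the elements $\pi_n$, $\pi_{n-1}$, $\tau_{n-1}$.
   Context: $\mathfrak A_n$ is the $\mathbb Z_2$-graded $\mathbb C$-algebra generated by odd elements $\tau_1,\dots,\tau_{n-1}$ with relations $\tau_k^2=1$, $(\tau_k\tau_{k+1})^3=1$, $(\tau_k\tau_l)^2=-1$ for $|k-l|>1$; $\mathfrak A_{m}\subset\mathfrak A_n$ ($m\le n$) via $\tau_k\mapsto\tau_k$. Set $\tau_{i,i+1}=\tau_i$, $\tau_{ij}=-\tau_{i,j-1}\tau_{j-1}\tau_{i,j-1}$ for $i<j-1$, $\tau_{ji}=-\tau_{ij}$, and $\pi_k=\sum_{i<k}\tau_{ik}$. Supercentralizer: $SZ(A,B)$ is the span of homogeneous $a\in A$ with $ab=(-1)^{p(a)p(b)}ba$ for all homogeneous $b\in B$; $SZ(A)=SZ(A,A)$. *)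

theory Defs
  imports Complex_Main
begin

text \<open>Terms of the free unital associative C-algebra on generators Gen k.
  The algebra A_n is the quotient of the terms in the generators tau_1..tau_{n-1}
  by the congruence eqv n generated by the C-algebra axioms and the defining relations.\<close>

datatype fexp = Gen nat | Scal complex | Add fexp fexp | Mul fexp fexp

primrec gens :: "fexp \<Rightarrow> nat set" where
  "gens (Gen k) = {k}"
| "gens (Scal c) = {}"
| "gens (Add x y) = gens x \<union> gens y"
| "gens (Mul x y) = gens x \<union> gens y"

definition wf :: "nat \<Rightarrow> fexp \<Rightarrow> bool" where
  "wf n x \<longleftrightarrow> gens x \<subseteq> {1..<n}"

definition neg :: "fexp \<Rightarrow> fexp" where
  "neg x = Mul (Scal (-1)) x"

definition pow3 :: "fexp \<Rightarrow> fexp" where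
  "pow3 x = Mul x (Mul x x)"

inductive eqv :: "nat \<Rightarrow> fexp \<Rightarrow> fexp \<Rightarrow> bool" for n :: nat where
  refl: "wf n x \<Longrightarrow> eqv n x x"
| sym: "eqv n x y \<Longrightarrow> eqv n y x"
| trans: "eqv n x y \<Longrightarrow> eqv n y z \<Longrightarrow> eqv n x z"
| add_cong: "eqv n x x' \<Longrightarrow> eqv n y y' \<Longrightarrow> eqv n (Add x y) (Add x' y')"
| mul_cong: "eqv n x x' \<Longrightarrow> eqv n y y' \<Longrightarrow> eqv n (Mul x y) (Mul x' y')"
| add_assoc: "wf n x \<Longrightarrow> wf n y \<Longrightarrow> wf n z \<Longrightarrow> eqv n (Add (Add x y) z) (Add x (Add y z))"
| add_comm: "wf n x \<Longrightarrow> wf n y \<Longrightarrow> eqv n (Add x y) (Add y x)"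
| add_zero: "wf n x \<Longrightarrow> eqv n (Add x (Scal 0)) x"
| add_inv: "wf n x \<Longrightarrow> eqv n (Add x (neg x)) (Scal 0)"
| mul_assoc: "wf n x \<Longrightarrow> wf n y \<Longrightarrow> wf n z \<Longrightarrow> eqv n (Mul (Mul x y) z) (Mul x (Mul y z))"
| mul_one_l: "wf n x \<Longrightarrow> eqv n (Mul (Scal 1) x) x"
| mul_one_r: "wf n x \<Longrightarrow> eqv n (Mul x (Scal 1)) x"
| distrib_l: "wf n x \<Longrightarrow> wf n y \<Longrightarrow> wf n z \<Longrightarrow> eqv n (Mul x (Add y z)) (Add (Mul x y) (Mul x z))"
| distrib_r: "wf n x \<Longrightarrow> wf n y \<Longrightarrow> wf n z \<Longrightarrow> eqv n (Mul (Add x y) z) (Add (Mul x z) (Mul y z))"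
| scal_add: "eqv n (Add (Scal a) (Scal b)) (Scal (a + b))"
| scal_mul: "eqv n (Mul (Scal a) (Scal b)) (Scal (a * b))"
| scal_central: "wf n x \<Longrightarrow> eqv n (Mul (Scal a) x) (Mul x (Scal a))"
| rel_sq: "1 \<le> k \<Longrightarrow> k < n \<Longrightarrow> eqv n (Mul (Gen k) (Gen k)) (Scal 1)"
| rel_braid: "1 \<le> k \<Longrightarrow> k + 1 < n \<Longrightarrow> eqv n (pow3 (Mul (Gen k) (Gen (k + 1)))) (Scal 1)"
| rel_far: "1 \<le> k \<Longrightarrow> 1 \<le> l \<Longrightarrow> k < n \<Longrightarrow> l < n \<Longrightarrow> (k + 1 < l \<or> l + 1 < k) \<Longrightarrow>
     eqv n (Mul (Mul (Gen k) (Gen l)) (Mul (Gen k) (Gen l))) (Scal (-1))"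

text \<open>Z2-grading: hom True = odd, hom False = even (on terms); an element of A_n is
  homogeneous of parity p iff it has a representative term of parity p.\<close>

inductive hom :: "bool \<Rightarrow> fexp \<Rightarrow> bool" where
  "hom True (Gen k)"
| "hom False (Scal c)"
| "hom p x \<Longrightarrow> hom p y \<Longrightarrow> hom p (Add x y)"
| "hom p x \<Longrightarrow> hom q y \<Longrightarrow> hom (p \<noteq> q) (Mul x y)"

definition homog :: "nat \<Rightarrow> bool \<Rightarrow> fexp \<Rightarrow> bool" where
  "homog n p x \<longleftrightarrow> wf n x \<and> (\<exists>y. hom p y \<and> eqv n x y)"

text \<open>Homogeneous generators of SZ(A_n, A_m) (m \<le> n, A_m \<subseteq> A_n via tau_k \<mapsto> tau_k).\<close>

definition sz_hom :: "nat \<Rightarrow> nat \<Rightarrow> fexp set" where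
  "sz_hom n m = {a. \<exists>p. homog n p a \<and>
      (\<forall>b q. wf m b \<and> homog m q b \<longrightarrow>
         eqv n (Mul a b) (if p \<and> q then neg (Mul b a) else Mul b a))}"

inductive_set lin_span :: "nat \<Rightarrow> fexp set \<Rightarrow> fexp set" for n S where
  "Scal 0 \<in> lin_span n S"
| "s \<in> S \<Longrightarrow> s \<in> lin_span n S"
| "x \<in> lin_span n S \<Longrightarrow> y \<in> lin_span n S \<Longrightarrow> Add x y \<in> lin_span n S"
| "x \<in> lin_span n S \<Longrightarrow> Mul (Scal c) x \<in> lin_span n S"
| "x \<in> lin_span n S \<Longrightarrow> eqv n x y \<Longrightarrow> y \<in> lin_span n S"

definition SZ :: "nat \<Rightarrow> nat \<Rightarrow> fexp set" where
  "SZ n m = lin_span n (sz_hom n m)"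

inductive_set alg_gen :: "nat \<Rightarrow> fexp set \<Rightarrow> fexp set" for n S where
  "Scal c \<in> alg_gen n S"
| "s \<in> S \<Longrightarrow> s \<in> alg_gen n S"
| "x \<in> alg_gen n S \<Longrightarrow> y \<in> alg_gen n S \<Longrightarrow> Add x y \<in> alg_gen n S"
| "x \<in> alg_gen n S \<Longrightarrow> y \<in> alg_gen n S \<Longrightarrow> Mul x y \<in> alg_gen n S"
| "x \<in> alg_gen n S \<Longrightarrow> eqv n x y \<Longrightarrow> y \<in> alg_gen n S"

text \<open>tau_rec i d = tau_{i, i+d+1}.\<close>
primrec tau_rec :: "nat \<Rightarrow> nat \<Rightarrow> fexp" where
  "tau_rec i 0 = Gen i"
| "tau_rec i (Suc d) = neg (Mul (Mul (tau_rec i d) (Gen (i + d + 1))) (tau_rec i d))"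

definition tau :: "nat \<Rightarrow> nat \<Rightarrow> fexp" where
  "tau i j = tau_rec i (j - i - 1)"

definition fsum :: "fexp list \<Rightarrow> fexp" where
  "fsum xs = foldr Add xs (Scal 0)"

definition pi :: "nat \<Rightarrow> fexp" where
  "pi k = fsum (map (\<lambda>i. tau i k) [1..<k])"

end

(* The symmetric group on {1..n} acts on A_n by superalgebra automorphisms which permute the
   indices of the elements tau_{ij}, the transposition (i j) acting as the super-conjugation by
   tau_{ij}; SZ(A_n, A_m) is the algebra of invariants of the symmetric group on {1..m}. Since the
   words in the tau_{ij} span A_n, averaging shows that SZ(A_n, A_m) is spanned by the orbit sums
   of words, and no basis of A_n is needed. For m = n - 2 an induction on the number of points of
   {1..m} moved by a word puts every orbit sum into the generated subalgebra: up to sign, a word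
   is a product of star-shaped words for the cycles through n and n - 1, possibly tau_{n-1,n},
   and a word v in A_m, on disjoint sets of points, and its orbit sum is, up to a positive factor
   and orbit sums of words that move fewer points, a product of powers of
   pi_n - tau_{n-1} and pi_{n-1} with the orbit sum of v and possibly tau_{n-1}. *)

theory Submission
  imports Defs "HOL-Combinatorics.Permutations"
begin

text \<open>The \<open>pi k\<close> are spin analogues of the Jucys-Murphy elements. Their powers
  reach every cycle because, for distinct indices, the product of the transpositions (x1 c), ...,
  (xk c) is one cycle through c: a power of the sum of the \<open>t x c\<close> contains all stars
  of that length, besides terms with a repeated index, which move fewer points. The obstacle is
  signs. A permutation has lifts that differ by a sign, no canonical lift is chosen, and an orbit
  sum may cancel to 0. So nothing is read off from coefficients: words are compared only up to sign,
  and the one sign that must not vary is the sign between two equivalent words as both run through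
  their orbits. It is constant because every relabelling is conjugation by an invertible element
  (\<open>ex_lift\<close>), up to a sign that depends on parities alone. The positive factor is
  never evaluated. It counts the disjoint choices of indices, it is positive because one such choice
  exists, and it can be divided out over the complex numbers.\<close>

section \<open>A ring containing all the algebras\<close>

lemma wf_simps [simp]:
  "wf n (Gen k) \<longleftrightarrow> 1 \<le> k \<and> k < n" "wf n (Scal c)"
  "wf n (Add x y) \<longleftrightarrow> wf n x \<and> wf n y" "wf n (Mul x y) \<longleftrightarrow> wf n x \<and> wf n y"
  "wf n (neg x) \<longleftrightarrow> wf n x"
  by (auto simp: wf_def neg_def)

lemma wf_mono: "wf m x \<Longrightarrow> m \<le> n \<Longrightarrow> wf n x"
  by (fastforce simp: wf_def)

lemma eqv_wf: "eqv n x y \<Longrightarrow> wf n x \<and> wf n y"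
  by (induction rule: eqv.induct) (auto simp: pow3_def)

lemma eqv_mono: "eqv m x y \<Longrightarrow> m \<le> n \<Longrightarrow> eqv n x y"
proof (induction rule: eqv.induct)
  case (trans x y z)
  then show ?case using eqv.trans by blast
next
  case (rel_braid k)
  then show ?case by (intro eqv.rel_braid) auto
qed (auto intro: eqv.intros wf_mono)

text \<open>\<open>R\<close> is the product of all the algebras, since a type cannot depend on \<open>n\<close>; it is only made a
  \<open>ring\<close>, because \<open>ring_1\<close> would require \<open>0 \<noteq> 1\<close>. The map \<open>K n\<close> below embeds the \<open>n\<close>-th algebra as a
  factor, whose unit is the idempotent \<open>K n (Scal 1)\<close>, called \<open>e\<close> in the locales.\<close>

definition eqv_all :: "(nat \<Rightarrow> fexp) \<Rightarrow> (nat \<Rightarrow> fexp) \<Rightarrow> bool" where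
  "eqv_all f g \<longleftrightarrow> (\<forall>n. eqv n (f n) (g n))"

\<comment> \<open>Partial, because \<open>eqv n\<close> is reflexive only on the terms that satisfy
  \<open>wf n\<close>.\<close>
quotient_type R = "nat \<Rightarrow> fexp" / partial: eqv_all
  unfolding eqv_all_def
proof (rule part_equivpI)
  show "\<exists>x. \<forall>n. eqv n (x n) (x n)"
    by (rule exI[of _ "\<lambda>_. Scal 0"]) (simp add: eqv.refl)
qed (auto intro!: sympI transpI intro: eqv.sym eqv.trans)

instantiation R :: ring
begin

lift_definition zero_R :: R is "\<lambda>_. Scal 0" by (simp add: eqv_all_def eqv.refl)
lift_definition plus_R :: "R \<Rightarrow> R \<Rightarrow> R" is "\<lambda>f g n. Add (f n) (g n)"
  by (simp add: eqv_all_def eqv.add_cong)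
lift_definition times_R :: "R \<Rightarrow> R \<Rightarrow> R" is "\<lambda>f g n. Mul (f n) (g n)"
  by (simp add: eqv_all_def eqv.mul_cong)
lift_definition uminus_R :: "R \<Rightarrow> R" is "\<lambda>f n. neg (f n)"
  by (auto simp: neg_def eqv_all_def intro!: eqv.mul_cong eqv.refl)
lift_definition minus_R :: "R \<Rightarrow> R \<Rightarrow> R" is "\<lambda>f g n. Add (f n) (neg (g n))"
  by (auto simp: neg_def eqv_all_def intro!: eqv.mul_cong eqv.add_cong intro: eqv.refl)

instance
proof
  fix a b c :: R
  show "a + b + c = a + (b + c)"
    by transfer (unfold eqv_all_def, meson eqv.add_assoc eqv_wf)
  show "a + b = b + a"
    by transfer (unfold eqv_all_def, meson eqv.add_comm eqv_wf)
  show "0 + a = a"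
    by transfer (unfold eqv_all_def, meson eqv.add_comm eqv.add_zero eqv.trans eqv_wf wf_simps(2))
  show "- a + a = 0"
    by transfer (unfold eqv_all_def, meson eqv.add_comm eqv.add_inv eqv.trans eqv_wf wf_simps(5))
  show "a - b = a + - b"
    by transfer (unfold eqv_all_def, meson eqv.refl eqv_wf wf_simps(3,5))
  show "a * b * c = a * (b * c)"
    by transfer (unfold eqv_all_def, meson eqv.mul_assoc eqv_wf)
  show "(a + b) * c = a * c + b * c"
    by transfer (unfold eqv_all_def, meson eqv.distrib_r eqv_wf)
  show "a * (b + c) = a * b + a * c"
    by transfer (unfold eqv_all_def, meson eqv.distrib_l eqv_wf)
qed

end

definition K :: "nat \<Rightarrow> fexp \<Rightarrow> R" where
  "K n x = abs_R (\<lambda>k. if k = n then x else Scal 0)"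

lemma abs_R_eq: "(\<And>k. eqv k (f k) (f k)) \<Longrightarrow> (\<And>k. eqv k (g k) (g k)) \<Longrightarrow>
  abs_R f = abs_R g \<longleftrightarrow> (\<forall>k. eqv k (f k) (g k))"
  using Quotient3_rel[OF Quotient3_R, of f g] by (auto simp: eqv_all_def)

text \<open>The bridge between terms and ring: identities are proved in \<open>R\<close> by ring
  algebra and pulled back to \<open>eqv n\<close> here.\<close>

lemma K_eq: "wf n x \<Longrightarrow> wf n y \<Longrightarrow> K n x = K n y \<longleftrightarrow> eqv n x y"
  unfolding K_def by (subst abs_R_eq) (auto intro: eqv.refl)

lemma K_zero: "K n (Scal 0) = 0"
  by (simp add: K_def zero_R_def)

lemma K_add: 
  assumes "wf n x" "wf n y"
  shows "K n (Add x y) = K n x + K n y"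
  \<comment> \<open>In the components other than \<open>n\<close> the claim reads 0 = 0 + 0.\<close>
  using assms eqv.sym[OF eqv.add_zero[of _ "Scal 0"]] unfolding K_def
  by (subst plus_R.abs_eq) (auto simp: eqv_all_def eqv.refl abs_R_eq intro!: abs_R_eq[THEN iffD2])

lemma K_mul: 
  assumes "wf n x" "wf n y"
  shows "K n (Mul x y) = K n x * K n y"
  using assms eqv.sym[OF eqv.scal_mul[of _ 0 0]] unfolding K_def
  by (subst times_R.abs_eq) (auto simp: eqv_all_def eqv.refl abs_R_eq intro!: abs_R_eq[THEN iffD2])

lemma K_neg: 
  assumes "wf n x"
  shows "K n (neg x) = - K n x"
  using assms eqv.sym[OF eqv.scal_mul[of _ "-1" 0]] unfolding K_def
  by (subst uminus_R.abs_eq) (auto simp: eqv_all_def neg_def eqv.refl abs_R_eq intro!: abs_R_eq[THEN iffD2])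

section \<open>Conjugation relations\<close>

text \<open>Braid and anticommutation form of the defining relations, better suited to moving
  factors past each other than the powers in \<open>rel_braid\<close> and
  \<open>rel_far\<close>.\<close>

locale spin_gens =
  fixes n :: nat and g :: "nat \<Rightarrow> 'a::ring" and e :: 'a
  assumes e_idem: "e * e = e"
    and e_g: "k \<in> {1..<n} \<Longrightarrow> e * g k = g k"
    and g_e: "k \<in> {1..<n} \<Longrightarrow> g k * e = g k"
    and g_sq: "k \<in> {1..<n} \<Longrightarrow> g k * g k = e"
    and g_braid: "1 \<le> k \<Longrightarrow> k + 1 < n \<Longrightarrow> g k * g (k+1) * g k = g (k+1) * g k * g (k+1)"
    and g_far: "k \<in> {1..<n} \<Longrightarrow> l \<in> {1..<n} \<Longrightarrow> k + 1 < l \<or> l + 1 < k \<Longrightarrow> g k * g l = - (g l * g k)"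
begin

text \<open>Membership in the corner of \<open>e\<close>: outside it \<open>e\<close> need not act
  as a unit, so cancelling a square requires this.\<close>

definition unital :: "'a \<Rightarrow> bool" where
  "unital x \<longleftrightarrow> e * x = x \<and> x * e = x"

lemma unital_mult: "unital x \<Longrightarrow> unital y \<Longrightarrow> unital (x * y)"
  unfolding unital_def by (metis mult.assoc)

lemma unital_minus: "unital x \<Longrightarrow> unital (- x)"
  unfolding unital_def by simp

lemma unital_g: "k \<in> {1..<n} \<Longrightarrow> unital (g k)"
  unfolding unital_def using e_g g_e by blast

lemma conj_mult:
  assumes "s * s = e" "unital x" "unital y" 
  shows "s * (x * y) * s = (s * x * s) * (s * y * s)"
proof -
  have "(s * x * s) * (s * y * s) = s * (x * (s * s)) * y * s"
    by (simp only: mult.assoc)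
  also have "\<dots> = s * (x * y) * s" 
    using assms by (simp add: unital_def) (simp add: mult.assoc)
  finally show ?thesis by simp
qed

lemma conj_mult3:
  assumes "s * s = e" "unital x" "unital y" "unital z"
  shows "s * (x * y * z) * s = (s * x * s) * (s * y * s) * (s * z * s)"
  using assms by (simp add: conj_mult unital_mult)

primrec tr :: "nat \<Rightarrow> nat \<Rightarrow> 'a" where
  "tr i 0 = g i"
| "tr i (Suc d) = - (tr i d * g (i + d + 1) * tr i d)"

text \<open>The antisymmetric extension of \<open>tr\<close>. The diagonal gets the junk value
  \<open>- g i\<close>; the lemmas keep the indices distinct.\<close>

definition t :: "nat \<Rightarrow> nat \<Rightarrow> 'a" where
  "t i j = (if i < j then tr i (j - i - 1) else - tr j (i - j - 1))"

lemma t_Suc: "t i (Suc i) = g i"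
  by (simp add: t_def)

lemma t_step: "i < j \<Longrightarrow> t i (Suc j) = - (t i j * g j * t i j)"
proof -
  assume "i < j"
  then obtain d where "j = Suc (i + d)"
    by (metis less_imp_Suc_add)
  then show ?thesis by (simp add: t_def)
qed

lemma t_swap: "i \<noteq> j \<Longrightarrow> t j i = - t i j"
  by (auto simp: t_def)


lemma t_induct [consumes 3, case_names Suc step]:
  fixes i j :: nat
  assumes "1 \<le> i" "i < j" "j \<le> n"
    and "P (Suc i)"
    and "\<And>j. i < j \<Longrightarrow> j < n \<Longrightarrow> P j \<Longrightarrow> P (Suc j)"
  shows "P j"
proof -
  have "Suc i \<le> j" using assms by simp
  then show ?thesis using assms(3)
    by (induction rule: dec_induct) (use assms(4,5) in auto)
qed

lemma unital_t_less:
  assumes "1 \<le> i" "i < j" "j \<le> n"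
  shows "unital (t i j)"
  using assms
  by (induction rule: t_induct)
     (use assms in \<open>auto simp: t_Suc t_step intro!: unital_g unital_mult unital_minus\<close>)

lemma unital_t: "i \<in> {1..n} \<Longrightarrow> j \<in> {1..n} \<Longrightarrow> i \<noteq> j \<Longrightarrow> unital (t i j)"
  using unital_t_less[of i j] unital_t_less[of j i] t_swap[of j i]
  by (cases "i < j") (auto intro: unital_minus)

lemma sq_conj:
  assumes "x * x = e" "y * y = e" "unital x" "unital y"
  shows "(x * y * x) * (x * y * x) = e"
proof -
  have "(x * y * x) * (x * y * x) = x * y * (x * x) * y * x" by (simp add: mult.assoc)
  also have "\<dots> = x * (y * y) * x" using assms by (simp add: unital_def mult.assoc)
  also have "\<dots> = e" using assms by (simp add: unital_def)
  finally show ?thesis .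
qed

lemma t_sq_less:
  assumes "1 \<le> i" "i < j" "j \<le> n"
  shows "t i j * t i j = e"
  using assms
proof (induction rule: t_induct)
  case Suc
  then show ?case using assms by (simp add: t_Suc g_sq)
next
  case (step j)
  then show ?case
    using assms sq_conj[of "t i j" "g j"] by (simp add: t_step g_sq unital_g unital_t_less)
qed

lemma t_sq: "i \<in> {1..n} \<Longrightarrow> j \<in> {1..n} \<Longrightarrow> i \<noteq> j \<Longrightarrow> t i j * t i j = e"
  using t_sq_less[of i j] t_sq_less[of j i] t_swap[of j i]
  by (cases "i < j") auto

lemma anticomm_conj:
  assumes "s * s = e" "unital x" "s * x = - (x * s)"
  shows "s * x * s = - x"
proof -
  have "s * x * s = - (x * (s * s))" using assms(3) by (simp add: mult.assoc)
  then show ?thesis using assms by (simp add: unital_def)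
qed

lemma conj_anticomm:
  assumes "s * s = e" "unital x" "unital s" "s * x * s = - x"
  shows "s * x = - (x * s)"
proof -
  have "s * x = s * x * (s * s)" using assms by (simp add: unital_def mult.assoc)
  also have "\<dots> = (s * x * s) * s" by (simp add: mult.assoc)
  also have "\<dots> = - (x * s)" using assms by simp
  finally show ?thesis .
qed

lemma g_conj_far: "k \<in> {1..<n} \<Longrightarrow> l \<in> {1..<n} \<Longrightarrow> k + 1 < l \<or> l + 1 < k \<Longrightarrow> g k * g l * g k = - g l"
  by (rule anticomm_conj) (auto intro!: g_far unital_g g_sq)

text \<open>Up to sign, \<open>t i j\<close> is a product of an odd number of generators with
  indices from \<open>i\<close> to \<open>j - 1\<close>, each of which anticommutes with
  \<open>g k\<close>.\<close>

lemma g_conj_t_far: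
  assumes "1 \<le> i" "i < j" "j \<le> n" "k \<in> {1..<n}" "j < k \<or> k + 1 < i"
  shows "g k * t i j * g k = - t i j"
  using assms
proof (induction rule: t_induct)
  case Suc
  show ?case using assms by (simp add: t_Suc, intro g_conj_far) auto
next
  case (step j)
  have "g k * t i (Suc j) * g k = - (g k * (t i j * g j * t i j) * g k)"
    using step assms(1) by (simp add: t_step)
  also have "\<dots> = - ((g k * t i j * g k) * (g k * g j * g k) * (g k * t i j * g k))"
    using step assms(1) by (subst conj_mult3) (auto intro!: g_sq unital_t_less unital_g)
  also have "\<dots> = - t i (Suc j)"
    using step assms(1) by (auto simp: t_step g_conj_far)
  finally show ?case .
qed

text \<open>Makes \<open>t_step\<close> symmetric: \<open>t i (Suc j)\<close> is also the negated
  conjugate of \<open>t i j\<close> by \<open>g j\<close>.\<close>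

lemma t_braid:
  assumes "1 \<le> i" "i < j" "j < n"
  shows "t i j * g j * t i j = g j * t i j * g j"
proof -
  have "1 \<le> i" "i < j" "j \<le> n" using assms by auto
  then have "j < n \<longrightarrow> t i j * g j * t i j = g j * t i j * g j"
  proof (induction rule: t_induct)
    case Suc
    then show ?case using g_braid[of i] assms by (simp add: t_Suc)
  next
    case (step j)
    show ?case
    proof
      assume *: "Suc j < n"
      define x a b where "x = t i j" and "a = g j" and "b = g (Suc j)"
      have 1: "t i (Suc j) = - (a * x * a)" 
        using step * by (simp add: t_step x_def a_def)
      have 2: "b * x * b = - x" unfolding b_def x_def
        using step * assms(1) by (intro g_conj_t_far) auto
      have 3: "b * x = - (x * b)"
        using 2 step * assms(1) unfolding b_def x_def
        by (intro conj_anticomm) (auto intro!: unital_g unital_t_less g_sq)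
      have 4: "a * b * a = b * a * b"
        using g_braid[of j] step * by (simp add: a_def b_def)
      have 5: "x * a * x = a * x * a"
        using step * by (simp add: a_def x_def)
      have 6: "x * b = - (b * x)" using 3 by simp
      \<comment> \<open>\<open>b\<close> involves only the indices above \<open>j\<close>, so it
        anticommutes with \<open>x\<close> (3 and 6); moving it past \<open>x\<close> brings
        together the triples to which 4 and 5 apply.\<close>
      have "(a * x * a) * b * (a * x * a) = a * x * (a * b * a) * x * a"
        by (simp add: mult.assoc)
      also have "\<dots> = a * (x * b) * a * (b * x) * a" unfolding 4 by (simp add: mult.assoc)
      also have "\<dots> = a * (- (b * x)) * a * (- (x * b)) * a" using 3 6 by metis
      also have "\<dots> = a * b * (x * a * x) * b * a" by (simp add: mult.assoc)
      also have "\<dots> = (a * b * a) * x * (a * b * a)" unfolding 5 by (simp add: mult.assoc)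
      also have "\<dots> = b * a * (b * x * b) * a * b" unfolding 4 by (simp add: mult.assoc)
      also have "\<dots> = - (b * (a * x * a) * b)" unfolding 2 by (simp add: mult.assoc)
      finally have "(a * x * a) * b * (a * x * a) = - (b * (a * x * a) * b)" .
      then show "t i (Suc j) * g (Suc j) * t i (Suc j) = g (Suc j) * t i (Suc j) * g (Suc j)"
        unfolding 1 b_def[symmetric] by simp
    qed
  qed
  then show ?thesis using assms by simp
qed

text \<open>Conjugation by \<open>g k\<close> is multiplicative, so \<open>t_step\<close> carries
  the claim from \<open>j\<close> to \<open>Suc j\<close>. The cases are the positions of
  \<open>k\<close> and \<open>Suc k\<close> relative to \<open>i\<close>, \<open>j\<close> and
  \<open>Suc j\<close>; where they meet the upper end, \<open>t_braid\<close> is needed.\<close>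

lemma conj_g:
  assumes "1 \<le> k" "k < n" "i \<in> {1..n}" "j \<in> {1..n}" "i \<noteq> j"
  shows "g k * t i j * g k = - t (transpose k (Suc k) i) (transpose k (Suc k) j)"
proof -
  have less: "g k * t i j * g k = - t (transpose k (Suc k) i) (transpose k (Suc k) j)"
    if "1 \<le> i" "i < j" "j \<le> n" for i j
    using that
  proof (induction rule: t_induct)
    case Suc
    consider "k = i" | "k = Suc i" | "Suc k = i" | "Suc k < i" | "Suc i < k" by linarith
    then show ?case
    proof cases
      case 1
      then show ?thesis using assms that by (simp add: t_Suc t_swap g_sq g_e e_g t_swap[of i "Suc i"])
    next
      case 2
      then show ?thesis using assms that t_braid[of i k] t_step[of i k]
        by (auto simp: t_Suc transpose_def)
    next
      case 3
      then show ?thesis using assms that t_step[of k i]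
        by (auto simp: t_Suc transpose_def)
    next
      case 4
      then show ?thesis using assms that
        by (auto simp: t_Suc transpose_def g_conj_far)
    next
      case 5
      then show ?thesis using assms that
        by (auto simp: t_Suc transpose_def g_conj_far)
    qed
  next
    case (step j)
    have u: "unital (t i j)" "unital (g j)" "unital (g k)" using step that assms
      by (auto intro!: unital_g unital_t_less)
    have "g k * t i (Suc j) * g k = - (g k * (t i j * g j * t i j) * g k)"
      using step by (simp add: t_step)
    also have "\<dots> = - ((g k * t i j * g k) * (g k * g j * g k) * (g k * t i j * g k))"
      using u assms by (subst conj_mult3) (auto intro!: g_sq)
    finally have *: "g k * t i (Suc j) * g k = 
       - ((g k * t i j * g k) * (g k * g j * g k) * (g k * t i j * g k))" .
    consider "Suc k < i" | "Suc k = i" | "k = i" "Suc i < j" | "k = i" "j = Suc i" 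
      | "i < k" "Suc k < j" | "i < k" "Suc k = j" | "k = j" | "k = Suc j" | "Suc j < k"
      using step by linarith
    then show ?case
    proof cases
      case 1
      then show ?thesis using step that assms by (subst g_conj_t_far) (auto simp: transpose_def)
    next
      case 2
      then show ?thesis using * step that assms 
        by (auto simp: transpose_def g_conj_far t_step)
    next
      case 3
      then show ?thesis using * step that assms
        by (auto simp: transpose_def g_conj_far t_step)
    next
      case 4
      have "g i * (g i * g j * g i) * g i = (g i * g i) * g j * (g i * g i)"
        by (simp add: mult.assoc)
      also have "\<dots> = g j" using 4 assms step by (simp add: g_sq e_g g_e)
      finally show ?thesis using 4 step that assms
        by (auto simp: transpose_def t_step t_Suc)
    next
      case 5
      then show ?thesis using * step that assms
        by (auto simp: transpose_def g_conj_far t_step)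
    next
      case 6
      \<comment> \<open>The delicate position: \<open>g k\<close> and \<open>g j\<close> are
        neighbours. As \<open>x\<close> ends at \<open>k\<close>, below \<open>j\<close>, it
        anticommutes with \<open>g j\<close>, which can thus be carried through
        \<open>x * g k * x\<close>.\<close>
      define x where "x = t i k"
      have ux: "unital x" using 6 step that by (auto simp: x_def intro!: unital_t_less)
      have 1: "g k * t i j * g k = - x"
        using 6 step that assms by (auto simp: transpose_def x_def)
      have 2: "g k * g j * g k = g j * g k * g j"
        using g_braid[of k] 6 assms step by auto
      have 3: "g j * x * g j = - x"
        using 6 step that by (auto simp: x_def intro!: g_conj_t_far)
      have 4: "g j * x = - (x * g j)"
        using 3 ux u g_sq[of j] step that by (intro conj_anticomm) auto
      have 5: "x * g j = - (g j * x)" using 4 by simp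
      have 7: "t i j = - (x * g k * x)" using t_step[of i k] 6 by (simp add: x_def)
      have "x * (g j * g k * g j) * x = (x * g j) * g k * (g j * x)"
        by (simp add: mult.assoc)
      also have "\<dots> = (- (g j * x)) * g k * (- (x * g j))" using 4 5 by metis
      also have "\<dots> = g j * (x * g k * x) * g j" by (simp add: mult.assoc)
      also have "\<dots> = - (g j * t i j * g j)" by (simp add: 7)
      also have "\<dots> = t i (Suc j)" using t_braid[of i j] t_step[of i j] step that by simp
      finally show ?thesis using 6 unfolding * 1 2 by (simp add: transpose_def)
    next
      case 7
      have "t i (Suc j) = - (g j * t i j * g j)" using t_braid[of i j] t_step[of i j] step that by simp
      then have "g j * t i (Suc j) * g j = - ((g j * g j) * t i j * (g j * g j))"
        by (simp add: mult.assoc)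
      then show ?thesis using 7 step that assms u by (auto simp: transpose_def g_sq unital_def)
    next
      case 8
      then show ?thesis using step that assms t_braid[of i k] t_step[of i k]
        by (auto simp: transpose_def)
    next
      case 9
      then show ?thesis using step that assms by (subst g_conj_t_far) (auto simp: transpose_def)
    qed
  qed
  show ?thesis
  proof (cases "i < j")
    case True
    then show ?thesis using less assms by simp
  next
    case False
    then have "g k * t j i * g k = - t (transpose k (Suc k) j) (transpose k (Suc k) i)"
      using less assms by simp
    moreover have "t (transpose k (Suc k) i) (transpose k (Suc k) j) = 
        - t (transpose k (Suc k) j) (transpose k (Suc k) i)"
      using assms by (intro t_swap) (metis transpose_involutory)
    ultimately show ?thesis using assms t_swap[of j i] by simp
  qed
qed

text \<open>Induction along the identity (i j+1) = (i j)(j j+1)(i j) of transpositions: the three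
  conjugations contribute three signs, while the minus sign of \<open>t_step\<close> occurs
  twice.\<close>

lemma t_conj:
  assumes "i \<in> {1..n}" "j \<in> {1..n}" "i \<noteq> j" "k \<in> {1..n}" "l \<in> {1..n}" "k \<noteq> l"
  shows "t i j * t k l * t i j = - t (transpose i j k) (transpose i j l)"
proof -
  have less: "t i j * t k l * t i j = - t (transpose i j k) (transpose i j l)"
    if "1 \<le> i" "i < j" "j \<le> n" "k \<in> {1..n}" "l \<in> {1..n}" "k \<noteq> l" for i j k l
    using that
  proof (induction arbitrary: k l rule: t_induct)
    case Suc
    then show ?case using that conj_g[of i k l] by (simp add: t_Suc)
  next
    case (step j)
    let ?a = "transpose i j" and ?b = "transpose j (Suc j)"
    have m: "?a x \<in> {1..n}" "?b x \<in> {1..n}" if "x \<in> {1..n}" for x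
      using step that \<open>1 \<le> i\<close> by (auto simp: transpose_def)
    have d: "?a x \<noteq> ?a y" "?b x \<noteq> ?b y" if "x \<noteq> y" for x y
      using that by (metis transpose_involutory)+
    have "t i (Suc j) * t k l * t i (Suc j) =
       t i j * (g j * (t i j * t k l * t i j) * g j) * t i j"
      by (simp add: t_step[OF step(1)] mult.assoc)
    also have "\<dots> = t i j * (g j * (- t (?a k) (?a l)) * g j) * t i j"
      using step by (subst step.IH[of k l]) auto
    also have "\<dots> = - t (?a (?b (?a k))) (?a (?b (?a l)))"
    proof -
      have 1: "g j * (- t (?a k) (?a l)) * g j = t (?b (?a k)) (?b (?a l))"
        using step m d conj_g[of j "?a k" "?a l"] that(1) by simp
      show ?thesis unfolding 1 using step m d by (intro step.IH) auto
    qed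
    finally have "t i (Suc j) * t k l * t i (Suc j) = - t (?a (?b (?a k))) (?a (?b (?a l)))" .
    moreover have "?a (?b (?a x)) = transpose i (Suc j) x" for x
      using step by (auto simp: transpose_def)
    ultimately show ?case by simp
  qed
  show ?thesis
  proof (cases "i < j")
    case True
    then show ?thesis using less assms by simp
  next
    case False
    then have "t j i * t k l * t j i = - t (transpose j i k) (transpose j i l)"
      using less assms by simp
    then show ?thesis using t_swap[of j i] assms by (simp add: transpose_commute)
  qed
qed

end

section \<open>Words\<close>

definition words :: "'i set \<Rightarrow> ('i \<times> 'i) list set" where
  "words U = {w. \<forall>(i, j) \<in> set w. i \<in> U \<and> j \<in> U \<and> i \<noteq> j}"

definition relabel :: "('i \<Rightarrow> 'i) \<Rightarrow> ('i \<times> 'i) list \<Rightarrow> ('i \<times> 'i) list" where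
  "relabel \<sigma> = map (map_prod \<sigma> \<sigma>)"

text \<open>For distinct \<open>xs\<close> not containing \<open>c\<close>, the underlying
  permutation is a single cycle on \<open>c\<close> and \<open>xs\<close>.\<close>

definition star :: "'i \<Rightarrow> 'i list \<Rightarrow> ('i \<times> 'i) list" where
  "star c = map (\<lambda>x. (x, c))"

text \<open>Parities are truth values, as in \<open>hom\<close>: \<open>\<noteq>\<close> is their
  sum and \<open>\<and>\<close> their product modulo 2.\<close>

definition sg :: "bool \<Rightarrow> 'a::ab_group_add \<Rightarrow> 'a" where
  "sg p x = (if p then - x else x)"

definition supp :: "('i \<times> 'i) list \<Rightarrow> 'i set" where
  "supp w = fst ` set w \<union> snd ` set w"

lemma words_Nil [simp]: "[] \<in> words U"
  and words_Cons [simp]: "(i, j) # w \<in> words U \<longleftrightarrow> i \<in> U \<and> j \<in> U \<and> i \<noteq> j \<and> w \<in> words U"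
  and words_append [simp]: "u @ v \<in> words U \<longleftrightarrow> u \<in> words U \<and> v \<in> words U"
  and words_rev [simp]: "rev u \<in> words U \<longleftrightarrow> u \<in> words U"
  by (auto simp: words_def)

lemma words_mono: "w \<in> words U \<Longrightarrow> U \<subseteq> V \<Longrightarrow> w \<in> words V"
  by (auto simp: words_def)

lemma words_iff_supp: "w \<in> words U \<longleftrightarrow> supp w \<subseteq> U \<and> (\<forall>(i, j) \<in> set w. i \<noteq> j)"
  by (force simp: words_def supp_def)

lemma supp_Nil [simp]: "supp [] = {}"
  and supp_Cons [simp]: "supp ((i, j) # w) = insert i (insert j (supp w))"
  and supp_append [simp]: "supp (u @ v) = supp u \<union> supp v"
  and supp_relabel: "supp (relabel \<sigma> w) = \<sigma> ` supp w"
  and supp_star: "supp (star c xs) \<subseteq> insert c (set xs)"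
  and finite_supp [simp]: "finite (supp w)"
  by (auto simp: supp_def relabel_def image_Un image_image star_def)

lemma relabel_simps [simp]:
  "relabel \<sigma> [] = []" "relabel \<sigma> ((i, j) # w) = (\<sigma> i, \<sigma> j) # relabel \<sigma> w"
  "relabel \<sigma> (u @ v) = relabel \<sigma> u @ relabel \<sigma> v" "length (relabel \<sigma> w) = length w"
  "relabel id w = w" "relabel (\<lambda>x. x) w = w"
  by (auto simp: relabel_def map_prod.id map_prod.id[unfolded id_def])

lemma relabel_comp: "relabel \<sigma> (relabel \<tau> w) = relabel (\<sigma> \<circ> \<tau>) w"
  by (simp add: relabel_def map_prod.comp)

lemma relabel_star: "relabel \<sigma> (star c xs) = star (\<sigma> c) (map \<sigma> xs)"
  by (simp add: relabel_def star_def)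

lemma relabel_cong: "(\<And>x. x \<in> supp w \<Longrightarrow> \<sigma> x = \<tau> x) \<Longrightarrow> relabel \<sigma> w = relabel \<tau> w"
  by (force simp: relabel_def supp_def)

lemma relabel_id_on: "(\<And>x. x \<in> supp w \<Longrightarrow> \<sigma> x = x) \<Longrightarrow> relabel \<sigma> w = w"
  using relabel_cong[of w \<sigma> id] by simp

lemma relabel_words:
  assumes "\<sigma> permutes S" "S \<subseteq> U"
  shows "relabel \<sigma> w \<in> words U \<longleftrightarrow> w \<in> words U"
  using permutes_in_image[OF permutes_subset[OF assms]] permutes_inj[OF assms(1)]
  by (fastforce simp: words_def relabel_def inj_eq)

lemma star_simps [simp]:
  "star c [] = []" "star c (x # xs) = (x, c) # star c xs" "star c (xs @ ys) = star c xs @ star c ys"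
  "length (star c xs) = length xs"
  by (auto simp: star_def)

lemma star_words: "set xs \<subseteq> U \<Longrightarrow> c \<in> U \<Longrightarrow> c \<notin> set xs \<Longrightarrow> star c xs \<in> words U"
  by (auto simp: words_def star_def)

lemma sg_simps [simp]:
  "sg p (- x) = sg (\<not> p) x" "- sg p x = sg (\<not> p) x" "sg p (x + y) = sg p x + sg p y" "sg p 0 = 0" "sg False x = x"
  "sg True x = - x" "sg p (sg q x) = sg (p \<noteq> q) x"
  by (auto simp: sg_def)

lemma sg_mult: "sg p x * y = sg p (x * y)" "x * sg p y = sg p (x * (y::'a::ring))"
  by (auto simp: sg_def)

lemma sg_sum: "sg p (sum f A) = (\<Sum>x\<in>A. sg p (f x))"
  by (auto simp: sg_def sum_negf)

lemma transpose_in: "a \<in> S \<Longrightarrow> b \<in> S \<Longrightarrow> x \<in> S \<Longrightarrow> transpose a b x \<in> S"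
  by (auto simp: transpose_def)

text \<open>The complements of \<open>D\<close> and of its image in the finite set \<open>M\<close>
  have equal size, so any bijection between them completes \<open>f\<close>.\<close>

lemma ex_permutes_extending:
  assumes "finite M" "D \<subseteq> M" "inj_on f D" "f ` D \<subseteq> M"
  obtains h where "h permutes M" "\<And>x. x \<in> D \<Longrightarrow> h x = f x"
proof -
  have "card (M - D) = card (M - f ` D)"
    using assms by (simp add: card_Diff_subset finite_subset card_image)
  then obtain k where k: "bij_betw k (M - D) (M - f ` D)"
    using assms(1) by (metis finite_Diff finite_same_card_bij)
  define h where "h x = (if x \<in> D then f x else if x \<in> M then k x else x)" for x
  have "bij_betw h D (f ` D)"
    using assms(3) by (subst bij_betw_cong[of D h f]) (auto simp: h_def bij_betw_def)
  moreover have "bij_betw h (M - D) (M - f ` D)"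
    using k by (subst bij_betw_cong[of _ h k]) (auto simp: h_def)
  ultimately have "bij_betw h (D \<union> (M - D)) (f ` D \<union> (M - f ` D))"
    by (rule bij_betw_combine) auto
  then have "bij_betw h M M" using assms by (simp add: Un_absorb1)
  then have "h permutes M" 
    using assms(2) by (intro bij_imp_permutes) (auto simp: h_def)
  then show ?thesis using that by (auto simp: h_def)
qed

text \<open>The order of the indices, on which the recursion for the tau_{ij} depends, is left
  behind: these rules are symmetric under all permutations of \<open>I\<close>.\<close>

locale spin_words =
  fixes I :: "'i set" and t :: "'i \<Rightarrow> 'i \<Rightarrow> 'a::ring" and e :: 'a
  assumes e_idem: "e * e = e"
    and e_t: "i \<in> I \<Longrightarrow> j \<in> I \<Longrightarrow> i \<noteq> j \<Longrightarrow> e * t i j = t i j"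
    and t_e: "i \<in> I \<Longrightarrow> j \<in> I \<Longrightarrow> i \<noteq> j \<Longrightarrow> t i j * e = t i j"
    and t_sq: "i \<in> I \<Longrightarrow> j \<in> I \<Longrightarrow> i \<noteq> j \<Longrightarrow> t i j * t i j = e"
    and t_conj: "i \<in> I \<Longrightarrow> j \<in> I \<Longrightarrow> i \<noteq> j \<Longrightarrow> k \<in> I \<Longrightarrow> l \<in> I \<Longrightarrow> k \<noteq> l \<Longrightarrow>
      t i j * t k l * t i j = - t (transpose i j k) (transpose i j l)"
begin

definition ev :: "('i \<times> 'i) list \<Rightarrow> 'a" where
  "ev w = foldr (\<lambda>(i, j) x. t i j * x) w e"

lemma ev_simps [simp]: "ev [] = e" "ev ((i, j) # w) = t i j * ev w"
  by (auto simp: ev_def)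

lemma e_ev: "w \<in> words I \<Longrightarrow> e * ev w = ev w" and ev_e: "w \<in> words I \<Longrightarrow> ev w * e = ev w"
  by (induction w) (auto simp: e_idem e_t mult.assoc simp flip: mult.assoc[of e])

lemma ev_append: "u \<in> words I \<Longrightarrow> v \<in> words I \<Longrightarrow> ev (u @ v) = ev u * ev v"
  by (induction u) (auto simp: e_ev mult.assoc)

lemma t_swap: "i \<in> I \<Longrightarrow> j \<in> I \<Longrightarrow> i \<noteq> j \<Longrightarrow> t j i = - t i j"
  using t_conj[of i j i j] t_sq[of i j] e_t[of i j] by simp

lemma t_conj_ev:
  assumes "i \<in> I" "j \<in> I" "i \<noteq> j" "w \<in> words I"
  shows "t i j * ev w * t i j = sg (odd (length w)) (ev (relabel (transpose i j) w))"
  using assms(4)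
proof (induction w)
  case Nil
  then show ?case using assms by (simp add: t_e t_sq)
next
  case (Cons p w)
  obtain k l where p: "p = (k, l)" by fastforce
  have w: "k \<in> I" "l \<in> I" "k \<noteq> l" "w \<in> words I" using Cons.prems p by auto
  have "t i j * ev (p # w) * t i j = t i j * t k l * (t i j * t i j) * ev w * t i j"
    using assms w by (simp add: p t_sq mult.assoc e_ev flip: mult.assoc[of e])
  also have "\<dots> = (t i j * t k l * t i j) * (t i j * ev w * t i j)"
    by (simp only: mult.assoc)
  finally show ?case using w assms Cons.IH by (simp add: p t_conj sg_mult)
qed

text \<open>The word \<open>g\<close> is a lift of \<open>\<sigma>\<close> to the spin cover of the symmetric group.\<close>

lemma ex_lift:
  assumes "finite S" "\<sigma> permutes S" "S \<subseteq> I"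
  shows "\<exists>g \<in> words S. \<forall>w \<in> words I.
    ev g * ev w * ev (rev g) = sg (odd (length g) \<and> odd (length w)) (ev (relabel \<sigma> w))"
  using assms(2,1)
proof (induction rule: permutes_induct)
  case id
  show ?case by (rule bexI[of _ "[]"]) (auto simp: e_ev ev_e)
next
  case (swap a b \<sigma>)
  obtain g where g: "g \<in> words S" "\<And>w. w \<in> words I \<Longrightarrow>
      ev g * ev w * ev (rev g) = sg (odd (length g) \<and> odd (length w)) (ev (relabel \<sigma> w))"
    using swap by blast
  have ab: "a \<in> I" "b \<in> I" "a \<noteq> b" and gI: "g \<in> words I"
    using swap assms(3) g(1) words_mono by auto
  show ?case
  proof (intro bexI[of _ "(a, b) # g"] ballI)
    fix w assume w: "w \<in> words I"
    have r: "relabel \<sigma> w \<in> words I" using w swap assms(3) relabel_words by blast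
    have "ev ((a, b) # g) * ev w * ev (rev ((a, b) # g)) =
       t a b * (ev g * ev w * ev (rev g)) * t a b"
      using ab gI by (simp add: ev_append mult.assoc t_e)
    also have "\<dots> = sg (odd (length ((a, b) # g)) \<and> odd (length w)) (ev (relabel (transpose a b \<circ> \<sigma>) w))"
      using ab w r
      by (cases "odd (length w)") (auto simp: g(2) sg_mult t_conj_ev relabel_comp)
    finally show "ev ((a, b) # g) * ev w * ev (rev ((a, b) # g)) = \<dots>" .
  qed (use swap g(1) in auto)
qed

text \<open>Spans and subalgebras do not notice the sign. The parity is recorded because conjugation
  signs depend on it, and nothing in the locale excludes that words of different parity have the
  same value.\<close>

definition word_eq :: "('i \<times> 'i) list \<Rightarrow> ('i \<times> 'i) list \<Rightarrow> bool" (infix "\<approx>" 50) where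
  "u \<approx> v \<longleftrightarrow> u \<in> words I \<and> v \<in> words I \<and> odd (length u) = odd (length v) \<and>
     (ev u = ev v \<or> ev u = - ev v)"

lemma word_eq_refl: "u \<in> words I \<Longrightarrow> u \<approx> u"
  by (simp add: word_eq_def)

lemma word_eq_sym: "u \<approx> v \<Longrightarrow> v \<approx> u"
  by (auto simp: word_eq_def)

lemma word_eq_trans [trans]: "u \<approx> v \<Longrightarrow> v \<approx> w \<Longrightarrow> u \<approx> w"
  by (auto simp: word_eq_def)

lemma word_eq_append: "u \<approx> u' \<Longrightarrow> v \<approx> v' \<Longrightarrow> u @ v \<approx> u' @ v'"
  by (auto simp: word_eq_def ev_append)

lemma word_eq_Cons: "i \<in> I \<Longrightarrow> j \<in> I \<Longrightarrow> i \<noteq> j \<Longrightarrow> v \<approx> v' \<Longrightarrow> (i, j) # v \<approx> (i, j) # v'"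
  using word_eq_append[of "[(i, j)]" "[(i, j)]" v v'] by (simp add: word_eq_refl)

lemma word_eq_cancel: 
  assumes "i \<in> I" "j \<in> I" "i \<noteq> j" "v \<in> words I"
  shows "(i, j) # (i, j) # v \<approx> v"
proof -
  have "t i j * (t i j * ev v) = ev v"
    using assms by (simp add: t_sq e_ev flip: mult.assoc)
  then show ?thesis using assms by (simp add: word_eq_def)
qed

lemma word_eq_flip: "i \<in> I \<Longrightarrow> j \<in> I \<Longrightarrow> i \<noteq> j \<Longrightarrow> v \<in> words I \<Longrightarrow> (i, j) # v \<approx> (j, i) # v"
  by (simp add: word_eq_def t_swap[of i j])

lemma word_eq_move:
  assumes "i \<in> I" "j \<in> I" "i \<noteq> j" "w \<in> words I"
  shows "(i, j) # w \<approx> relabel (transpose i j) w @ [(i, j)]"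
proof -
  have p: "transpose i j permutes {i, j}"
    by (simp add: permutes_swap_id)
  have r: "relabel (transpose i j) w \<in> words I"
    using relabel_words[OF p] assms by auto
  have "t i j * ev w = t i j * ev w * (t i j * t i j)"
    using assms by (simp add: t_sq ev_e mult.assoc)
  also have "\<dots> = (t i j * ev w * t i j) * t i j" by (simp only: mult.assoc)
  also have "\<dots> = sg (odd (length w)) (ev (relabel (transpose i j) w @ [(i, j)]))"
    using assms r by (simp add: t_conj_ev sg_mult ev_append t_e)
  finally show ?thesis using assms r by (auto simp: word_eq_def sg_def)
qed

text \<open>The cosets of the stabilizer of \<open>a\<close>: a permutation fixes \<open>a\<close>,
  or it is (i a) times one that does. A further letter is pushed through the representative by (x
  a)(i a) = (i a)(x i) or (x y)(i a) = (i' a)(x y), where i' is the image of i under (x y).\<close>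

lemma coset_form:
  assumes "insert a U \<subseteq> I" "a \<notin> U" "w \<in> words (insert a U)"
  shows "(\<exists>v \<in> words U. w \<approx> v) \<or> (\<exists>i \<in> U. \<exists>v \<in> words U. w \<approx> (i, a) # v)"
  using assms(3)
proof (induction w)
  case Nil
  then show ?case by (intro disjI1 bexI[of _ "[]"]) (auto simp: word_eq_refl)
next
  case (Cons p w)
  have UI: "v \<in> words I" if "v \<in> words U" for v using that assms words_mono by auto
  have aI: "a \<in> I" using assms by auto
  have iI: "i \<in> I" "i \<noteq> a" "a \<noteq> i" if "i \<in> U" for i using that assms by auto
  have star_case: "(\<exists>v' \<in> words U. (x, a) # w \<approx> v') \<or> (\<exists>i \<in> U. \<exists>v' \<in> words U. (x, a) # w \<approx> (i, a) # v')"
    if x: "x \<in> U" and w: "w \<in> words (insert a U)" for x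
    using Cons.IH[OF w]
  proof (elim disjE bexE)
    fix v assume v: "v \<in> words U" "w \<approx> v"
    then have "(x, a) # w \<approx> (x, a) # v" using x aI iI by (intro word_eq_Cons) auto
    then show ?thesis using v x by blast
  next
    fix i v assume v: "i \<in> U" "v \<in> words U" "w \<approx> (i, a) # v"
    then have *: "(x, a) # w \<approx> (x, a) # (i, a) # v" using x aI iI by (intro word_eq_Cons) auto
    show ?thesis
    proof (cases "x = i")
      case True
      have "(x, a) # (i, a) # v \<approx> v"
        unfolding True using v aI iI UI by (intro word_eq_cancel) auto
      then show ?thesis using * v word_eq_trans by blast
    next
      case False
      have "[(i, a)] @ [(x, i)] \<approx> relabel (transpose i a) [(x, i)] @ [(i, a)]"
        using word_eq_move[of i a "[(x, i)]"] v x aI iI False by simp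
      also have "relabel (transpose i a) [(x, i)] = [(x, a)]"
        using False x iI by (auto simp: transpose_def)
      finally have "([(i, a)] @ [(x, i)]) @ v \<approx> ([(x, a)] @ [(i, a)]) @ v"
        by (rule word_eq_append) (use v UI word_eq_refl in auto)
      then have "(x, a) # (i, a) # v \<approx> (i, a) # (x, i) # v"
        by (simp add: word_eq_sym)
      with * have "(x, a) # w \<approx> (i, a) # (x, i) # v" by (rule word_eq_trans)
      moreover have "(x, i) # v \<in> words U" using v x False by auto
      ultimately show ?thesis using v by blast
    qed
  qed
  obtain x y where p: "p = (x, y)" by fastforce
  have w: "w \<in> words (insert a U)" and xy: "x \<in> insert a U" "y \<in> insert a U" "x \<noteq> y"
    using Cons.prems p by auto
  consider "y = a" "x \<in> U" | "x = a" "y \<in> U" | "x \<in> U" "y \<in> U" using xy by auto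
  then show ?case
  proof cases
    case 1
    then show ?thesis using star_case w p by simp
  next
    case 2
    have "w \<in> words I" using w assms words_mono by blast
    then have "(x, y) # w \<approx> (y, a) # w" using 2 aI iI by (auto intro: word_eq_flip)
    then show ?thesis using star_case[OF 2(2) w] p word_eq_trans by blast
  next
    case 3
    from Cons.IH[OF w] show ?thesis
    proof (elim disjE bexE)
      fix v assume v: "v \<in> words U" "w \<approx> v"
      then have "(x, y) # w \<approx> (x, y) # v" using 3 xy iI by (intro word_eq_Cons) auto
      moreover have "(x, y) # v \<in> words U" using 3 xy v by auto
      ultimately show ?thesis using p by blast
    next
      fix i v assume v: "i \<in> U" "v \<in> words U" "w \<approx> (i, a) # v"
      let ?i = "transpose x y i"
      have "(x, y) # w \<approx> (x, y) # (i, a) # v" using 3 xy iI v by (intro word_eq_Cons) auto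
      also have "\<dots> = [(x, y)] @ [(i, a)] @ v" by simp
      also have "[(x, y)] @ [(i, a)] \<approx> relabel (transpose x y) [(i, a)] @ [(x, y)]"
        using word_eq_move[of x y "[(i, a)]"] 3 xy v iI aI by simp
      then have "([(x, y)] @ [(i, a)]) @ v \<approx> (relabel (transpose x y) [(i, a)] @ [(x, y)]) @ v"
        by (rule word_eq_append) (use v UI word_eq_refl in auto)
      then have "[(x, y)] @ [(i, a)] @ v \<approx> (relabel (transpose x y) [(i, a)] @ [(x, y)]) @ v"
        by simp
      also have "(relabel (transpose x y) [(i, a)] @ [(x, y)]) @ v = (?i, a) # (x, y) # v"
        using 3 iI by (auto simp: transpose_def)
      finally have "p # w \<approx> (?i, a) # (x, y) # v" using p by simp
      moreover have "?i \<in> U" "(x, y) # v \<in> words U" using 3 xy v by (auto intro: transpose_in)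
      ultimately show ?thesis by blast
    qed
  qed
qed

text \<open>Splits off the cycle through \<open>a\<close>. After \<open>coset_form\<close> the
  induction hypothesis is applied to the remaining word with \<open>i\<close> as the new centre;
  moving \<open>(i, a)\<close> to the right past that star turns its centre into \<open>a\<close>
  and lengthens it by \<open>i\<close>.\<close>

lemma star_form:
  assumes "finite U" "insert a U \<subseteq> I" "a \<notin> U" "w \<in> words (insert a U)"
  shows "\<exists>xs v. distinct xs \<and> set xs \<subseteq> U \<and> v \<in> words (U - set xs) \<and> w \<approx> star a xs @ v"
  using assms
proof (induction "card U" arbitrary: U a w rule: less_induct)
  case less
  from coset_form[OF less.prems(2-4)] show ?case
  proof (elim disjE bexE)
    fix v assume "v \<in> words U" "w \<approx> v"
    then show ?thesis by (intro exI[of _ "[]"] exI[of _ v]) auto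
  next
    fix i v assume iv: "i \<in> U" "v \<in> words U" "w \<approx> (i, a) # v"
    have ia: "i \<in> I" "a \<in> I" "i \<noteq> a" using iv less.prems by auto
    have "card (U - {i}) < card U" using less.prems(1) iv(1) by (rule card_Diff1_less)
    then obtain ys v' where ys: "distinct ys" "set ys \<subseteq> U - {i}" "v' \<in> words (U - {i} - set ys)"
        "v \<approx> star i ys @ v'"
      using less.hyps[of "U - {i}" i v] less.prems iv by (auto simp: insert_absorb)
    have ws: "star i ys \<in> words I" "v' \<in> words I"
      using ys less.prems iv words_mono[of v'] by (auto intro!: star_words)
    have "w \<approx> (i, a) # v" by fact
    also have "(i, a) # v \<approx> (i, a) # star i ys @ v'" using ys ia by (intro word_eq_Cons) auto
    also have "((i, a) # star i ys) @ v' \<approx> (relabel (transpose i a) (star i ys) @ [(i, a)]) @ v'"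
      using ws ia by (intro word_eq_append word_eq_move word_eq_refl) auto
    then have "(i, a) # star i ys @ v' \<approx> (relabel (transpose i a) (star i ys) @ [(i, a)]) @ v'"
      by simp
    also have "map (transpose i a) ys = ys"
      using ys less.prems by (intro map_idI) (auto simp: transpose_def)
    then have "(relabel (transpose i a) (star i ys) @ [(i, a)]) @ v' = star a (ys @ [i]) @ v'"
      by (simp add: relabel_star)
    finally have "w \<approx> star a (ys @ [i]) @ v'" .
    moreover have "U - {i} - set ys = U - set (ys @ [i])" by auto
    ultimately show ?thesis using ys iv
      by (intro exI[of _ "ys @ [i]"] exI[of _ v']) auto
  qed
qed

lemma two_star_form:
  assumes "finite U" "insert b (insert a U) \<subseteq> I" "a \<notin> U" "b \<notin> U" "a \<noteq> b"
    "w \<in> words (insert b (insert a U))"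
  shows "\<exists>ys xs v \<epsilon>. distinct (ys @ xs) \<and> set (ys @ xs) \<subseteq> U \<and> v \<in> words (U - set (ys @ xs)) \<and>
    w \<approx> (star b ys @ star a xs @ v) @ (if \<epsilon> then [(a, b)] else [])"
proof -
  obtain ys v where ys: "distinct ys" "set ys \<subseteq> insert a U" "v \<in> words (insert a U - set ys)"
      "w \<approx> star b ys @ v"
    using star_form[of "insert a U" b w] assms by auto
  have wsI: "star b ys \<in> words I" "v \<in> words I"
    using ys assms words_mono[of v] by (auto intro!: star_words)
  show ?thesis
  proof (cases "a \<in> set ys")
    case False
    then have *: "insert a U - set ys = insert a (U - set ys)" by auto
    obtain xs v' where xs: "distinct xs" "set xs \<subseteq> U - set ys" "v' \<in> words (U - set ys - set xs)"
        "v \<approx> star a xs @ v'"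
      using star_form[of "U - set ys" a v] assms ys(3)[unfolded *] by auto
    have "w \<approx> star b ys @ v" by fact
    also have "star b ys @ v \<approx> star b ys @ star a xs @ v'"
      using xs wsI by (intro word_eq_append word_eq_refl)
    finally have "w \<approx> (star b ys @ star a xs @ v') @ (if False then [(a, b)] else [])" by simp
    moreover have "U - set ys - set xs = U - set (ys @ xs)" by auto
    ultimately show ?thesis using xs ys False 
      by (intro exI[of _ ys] exI[of _ xs] exI[of _ v'] exI[of _ False]) auto
  next
    \<comment> \<open>Now \<open>a\<close> and \<open>b\<close> lie on one cycle. Moving the letter
      \<open>(a, b)\<close> to the end cuts the star at \<open>b\<close> in two: the part behind the
      letter becomes a star at \<open>a\<close>.\<close>
    case True
    then obtain y1 y2 where y12: "ys = y1 @ a # y2" by (meson split_list)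
    let ?s = "transpose a b"
    have d: "set y1 \<subseteq> U" "set y2 \<subseteq> U" "v \<in> words (U - set (y1 @ y2))"
      using ys y12 by (auto elim!: words_mono)
    have m: "map ?s y2 = y2"
      using d assms by (intro map_idI) (auto simp: transpose_def)
    have rv: "relabel ?s v = v"
      using d(3) assms by (intro relabel_id_on) (auto simp: transpose_def words_iff_supp)
    have "w \<approx> star b y1 @ (a, b) # (star b y2 @ v)"
      using ys(4) by (simp add: y12)
    also have "\<dots> \<approx> star b y1 @ relabel ?s (star b y2 @ v) @ [(a, b)]"
      using wsI assms by (intro word_eq_append word_eq_refl word_eq_move) (auto simp: y12)
    also have "\<dots> = (star b y1 @ star a y2 @ v) @ (if True then [(a, b)] else [])"
      by (simp add: relabel_star m rv)
    finally show ?thesis using d ys(1)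
      by (intro exI[of _ y1] exI[of _ y2] exI[of _ v] exI[of _ True]) (auto simp: y12)
  qed
qed

end

section \<open>Orbit sums\<close>

lemma sum_lists_Suc:
  "(\<Sum>xs | set xs \<subseteq> M \<and> length xs = Suc k. f xs) =
   (\<Sum>x\<in>M. \<Sum>xs | set xs \<subseteq> M \<and> length xs = k. f (x # xs))"
proof -
  let ?L = "{xs. set xs \<subseteq> M \<and> length xs = k}"
  have "(\<Sum>x\<in>M. \<Sum>xs\<in>?L. f (x # xs)) = (\<Sum>(x, xs)\<in>M \<times> ?L. f (x # xs))"
    by (rule sum.cartesian_product)
  also have "\<dots> = (\<Sum>xs | set xs \<subseteq> M \<and> length xs = Suc k. f xs)"
    by (rule sum.reindex_bij_witness[of _ "\<lambda>xs. (hd xs, tl xs)" "\<lambda>(x, xs). x # xs"])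
       (auto simp: length_Suc_conv)
  finally show ?thesis ..
qed

context spin_words
begin

text \<open>The sum runs over the group and not over the distinct relabellings, so stabilizers cause
  multiplicities; in exchange, invariance is a mere reindexing.\<close>

definition orbit_sum :: "'i set \<Rightarrow> ('i \<times> 'i) list \<Rightarrow> 'a" where
  "orbit_sum M w = (\<Sum>\<sigma> | \<sigma> permutes M. ev (relabel \<sigma> w))"

lemma orbit_sum_relabel:
  assumes "h permutes M"
  shows "orbit_sum M (relabel h w) = orbit_sum M w"
  unfolding orbit_sum_def relabel_comp
  using sum_permutations_compose_right[OF assms, of "\<lambda>\<sigma>. ev (relabel \<sigma> w)"] by simp

lemma e_orbit_sum: "M \<subseteq> I \<Longrightarrow> w \<in> words I \<Longrightarrow> e * orbit_sum M w = orbit_sum M w"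
  unfolding orbit_sum_def sum_distrib_left
  by (intro sum.cong HOL.refl e_ev) (auto simp: relabel_words)

text \<open>Invariance under super-conjugation, from which the orbit sums of words in A_m are seen
  to lie in the supercenter.\<close>

lemma orbit_sum_conj:
  assumes "M \<subseteq> I" "x \<in> M" "y \<in> M" "x \<noteq> y" "w \<in> words I"
  shows "t x y * orbit_sum M w * t x y = sg (odd (length w)) (orbit_sum M w)"
proof -
  have "t x y * orbit_sum M w * t x y = (\<Sum>\<sigma> | \<sigma> permutes M. t x y * ev (relabel \<sigma> w) * t x y)"
    by (simp add: orbit_sum_def sum_distrib_left sum_distrib_right)
  also have "\<dots> = (\<Sum>\<sigma> | \<sigma> permutes M. sg (odd (length w)) (ev (relabel (transpose x y \<circ> \<sigma>) w)))"
    using assms by (intro sum.cong HOL.refl) (auto simp: t_conj_ev relabel_words subset_iff relabel_comp)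
  also have "\<dots> = sg (odd (length w)) (\<Sum>\<sigma> | \<sigma> permutes M. ev (relabel (transpose x y \<circ> \<sigma>) w))"
    by (simp add: sg_sum)
  also have "(\<Sum>\<sigma> | \<sigma> permutes M. ev (relabel (transpose x y \<circ> \<sigma>) w)) = orbit_sum M w"
    using setum_permutations_compose_left[of "transpose x y" M "\<lambda>\<sigma>. ev (relabel \<sigma> w)"]
      permutes_swap_id[of x M y] assms by (simp add: orbit_sum_def)
  finally show ?thesis .
qed

text \<open>The sign between two equivalent words survives relabelling unchanged: relabelling is
  conjugation by a lift, and equal parities give equal conjugation signs.\<close>

lemma orbit_sum_word_eq:
  assumes "finite M" "M \<subseteq> I" "w \<approx> w'"
  shows "orbit_sum M w = orbit_sum M w' \<or> orbit_sum M w = - orbit_sum M w'"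
proof -
  have w: "w \<in> words I" "w' \<in> words I" "odd (length w) = odd (length w')"
    using assms(3) by (auto simp: word_eq_def)
  obtain p where p: "ev w = sg p (ev w')"
    using assms(3) by (metis (full_types) sg_simps(5,6) word_eq_def)
  have "ev (relabel \<sigma> w) = sg p (ev (relabel \<sigma> w'))" if \<sigma>: "\<sigma> permutes M" for \<sigma>
  proof -
    obtain g q where g: "\<And>w. w \<in> words I \<Longrightarrow>
        ev g * ev w * ev (rev g) = sg (q \<and> odd (length w)) (ev (relabel \<sigma> w))"
      using ex_lift[OF assms(1) \<sigma> assms(2)] by blast
    show ?thesis using g[OF w(1)] g[OF w(2)] w(3) p
      by (cases "q \<and> odd (length w)"; cases p) (auto simp: sg_mult sg_def)
  qed
  then have "orbit_sum M w = sg p (orbit_sum M w')"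
    by (simp add: orbit_sum_def sg_sum)
  then show ?thesis by (auto simp: sg_def)
qed

lemma orbit_sum_snoc_fixed:
  assumes "M \<subseteq> I" "w \<in> words I" "a \<in> I - M" "b \<in> I - M" "a \<noteq> b"
  shows "orbit_sum M (w @ [(a, b)]) = orbit_sum M w * t a b"
  unfolding orbit_sum_def sum_distrib_right
  using assms by (intro sum.cong HOL.refl) (auto simp: relabel_words ev_append permutes_not_in t_e)

text \<open>The induction is on the number of points of \<open>M\<close> moved by a word. Up to sign the word is
  \<open>u = star b ys @ star a xs @ v\<close> with disjoint parts, possibly times \<open>(a, b)\<close>. Expanding
  \<open>B ^ length ys * A ^ length xs * orbit_sum M v\<close>, where \<open>B\<close> and \<open>A\<close> are the sums of all
  \<open>t x b\<close> and of all \<open>t x a\<close>, every term with disjoint parts is a relabelling of \<open>u\<close>, and all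
  other terms move fewer points.\<close>

lemma orbit_sum_in_subalgebra:
  fixes A :: "'a set"
  assumes M: "finite M" "a \<notin> M" "b \<notin> M" "a \<noteq> b" and I: "I = insert b (insert a M)"
    and A_e: "e \<in> A"
    and A_add: "\<And>x y. x \<in> A \<Longrightarrow> y \<in> A \<Longrightarrow> x + y \<in> A"
    and A_minus: "\<And>x. x \<in> A \<Longrightarrow> - x \<in> A"
    and A_mult: "\<And>x y. x \<in> A \<Longrightarrow> y \<in> A \<Longrightarrow> x * y \<in> A"
    and A_div: "\<And>(S :: ('i list \<times> 'i list \<times> ('i \<Rightarrow> 'i)) set) x. finite S \<Longrightarrow> S \<noteq> {} \<Longrightarrow>
      e * x = x \<Longrightarrow> (\<Sum>i\<in>S. x) \<in> A \<Longrightarrow> x \<in> A"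
    and A_a: "(\<Sum>x\<in>M. t x a) \<in> A" and A_b: "(\<Sum>x\<in>M. t x b) \<in> A" and A_ab: "t a b \<in> A"
    and A_M: "\<And>v. v \<in> words M \<Longrightarrow> orbit_sum M v \<in> A"
    and w: "w \<in> words I"
  shows "orbit_sum M w \<in> A"
  using w
proof (induction "card (supp w \<inter> M)" arbitrary: w rule: less_induct)
  case less
  have MI: "M \<subseteq> I" and ab: "a \<in> I" "b \<in> I" using I by auto
  have A_0: "0 \<in> A" using A_add[OF A_e A_minus[OF A_e]] by simp
  have A_sum: "(\<Sum>x\<in>S. f x) \<in> A" if "\<And>x. x \<in> S \<Longrightarrow> f x \<in> A" for S :: "'c set" and f
    using that by (induction S rule: infinite_finite_induct) (auto intro: A_0 A_add)
  define L where "L k = {xs. set xs \<subseteq> M \<and> length xs = k}" for k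
  have fin_L: "finite (L k)" for k unfolding L_def using M(1) by (rule finite_lists_length_eq)
  have star_I: "star c xs \<in> words I" if "xs \<in> L k" "c \<in> {a, b}" for xs k c
    using that M MI ab by (intro star_words) (auto simp: L_def)
  \<comment> \<open>This is the \<open>k\<close>-th power of the sum of the \<open>t x c\<close>.
    Lists in \<open>L k\<close> may repeat an entry, one of the two sources of bad terms
    below.\<close>
  have star_sum: "(\<Sum>xs\<in>L k. ev (star c xs)) \<in> A" if c: "c = a \<or> c = b" for c k
  proof (induction k)
    case 0
    have "L 0 = {[]}" by (auto simp: L_def)
    then show ?case by (simp add: A_e)
  next
    case (Suc k)
    have "(\<Sum>xs\<in>L (Suc k). ev (star c xs)) = (\<Sum>x\<in>M. t x c) * (\<Sum>xs\<in>L k. ev (star c xs))"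
      by (simp add: L_def sum_lists_Suc sum_product)
    then show ?case using c A_a A_b Suc A_mult by auto
  qed
  let ?U = "supp w \<inter> M"
  \<comment> \<open>The normal form is taken over the points of \<open>w\<close> itself, so it moves
    no further point of \<open>M\<close>; the final cardinality estimate rests on this.\<close>
  obtain ys xs v \<epsilon> where nf: "distinct (ys @ xs)" "set (ys @ xs) \<subseteq> ?U" "v \<in> words (?U - set (ys @ xs))"
      "w \<approx> (star b ys @ star a xs @ v) @ (if \<epsilon> then [(a, b)] else [])"
  proof -
    have "w \<in> words (insert b (insert a ?U))" using less.prems by (auto simp: words_iff_supp I)
    moreover have "insert b (insert a ?U) \<subseteq> I" using I by auto
    ultimately obtain ys xs v \<epsilon> where "distinct (ys @ xs) \<and> set (ys @ xs) \<subseteq> ?U \<and>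
        v \<in> words (?U - set (ys @ xs)) \<and> w \<approx> (star b ys @ star a xs @ v) @ (if \<epsilon> then [(a, b)] else [])"
      using two_star_form[of ?U b a w] M by (metis Int_iff finite_supp finite_Int)
    then show ?thesis using that by blast
  qed
  have vM: "v \<in> words M" using nf(3) by (auto elim: words_mono)
  have vI: "v \<in> words I" using vM MI words_mono by blast
  have v_supp: "supp v \<subseteq> ?U - set (ys @ xs)" using nf(3) by (simp add: words_iff_supp)
  let ?k = "length ys" and ?l = "length xs"
  define T where "T = L ?k \<times> L ?l \<times> {\<sigma>. \<sigma> permutes M}"
  define word where "word = (\<lambda>(ys', xs', \<sigma>). star b ys' @ star a xs' @ relabel \<sigma> v)"
  define u where "u = star b ys @ star a xs @ v"
  have fin_T: "finite T" unfolding T_def using fin_L M(1) finite_permutations by blast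
  have lists: "ys \<in> L ?k" "xs \<in> L ?l" using nf(2) by (auto simp: L_def)
  have word_I: "word p \<in> words I" if "p \<in> T" for p
    using that star_I vI relabel_words[OF _ MI] by (auto simp: word_def T_def)
  have uI: "u \<in> words I" using star_I lists vI by (simp add: u_def)
  define X where "X = (\<Sum>p\<in>T. ev (word p))"
  have "X = (\<Sum>(ys', xs', \<sigma>)\<in>T. ev (star b ys') * (ev (star a xs') * ev (relabel \<sigma> v)))"
    unfolding X_def word_def
    using star_I vI relabel_words[OF _ MI] by (intro sum.cong HOL.refl) (auto simp: ev_append T_def)
  also have "\<dots> = (\<Sum>ys'\<in>L ?k. \<Sum>xs'\<in>L ?l. \<Sum>\<sigma> | \<sigma> permutes M.
      ev (star b ys') * (ev (star a xs') * ev (relabel \<sigma> v)))"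
    by (simp only: T_def sum.cartesian_product)
  also have "\<dots> = (\<Sum>ys'\<in>L ?k. ev (star b ys')) * ((\<Sum>xs'\<in>L ?l. ev (star a xs')) * orbit_sum M v)"
    by (simp only: orbit_sum_def sum_distrib_left[symmetric] sum_distrib_right[symmetric])
  finally have X_A: "X \<in> A" using star_sum A_M[OF vM] A_mult by simp
  \<comment> \<open>\<open>T\<close> is stable under relabelling by \<tau>. Hence the orbit sums of
    all words from \<open>T\<close> add up to \<open>X\<close> times the order of the group, which
    gives \<open>total\<close>.\<close>
  have inv: "(\<Sum>p\<in>T. ev (relabel \<tau> (word p))) = X" if \<tau>: "\<tau> permutes M" for \<tau>
    unfolding X_def
  proof (rule sum.reindex_bij_witness[of _ "\<lambda>(ys', xs', \<sigma>). (map (inv \<tau>) ys', map (inv \<tau>) xs', inv \<tau> \<circ> \<sigma>)"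
        "\<lambda>(ys', xs', \<sigma>). (map \<tau> ys', map \<tau> xs', \<tau> \<circ> \<sigma>)"])
    have \<tau>': "inv \<tau> permutes M" using \<tau> by (rule permutes_inv)
    have fx: "\<tau> a = a" "\<tau> b = b" using \<tau> M permutes_not_in by metis+
    have map_L: "map \<sigma> zs \<in> L k" if "\<sigma> permutes M" "zs \<in> L k" for \<sigma> zs k
      using that by (auto simp: L_def permutes_in_image)
    have comp: "\<tau> \<circ> inv \<tau> = id" "inv \<tau> \<circ> \<tau> = id"
      using \<tau> by (simp_all add: permutes_inv_o)
    fix p assume p: "p \<in> T"
    obtain ys' xs' \<sigma> where pp: "p = (ys', xs', \<sigma>)" by (cases p)
    show "(case case p of (ys', xs', \<sigma>) \<Rightarrow> (map \<tau> ys', map \<tau> xs', \<tau> \<circ> \<sigma>) of 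
        (ys', xs', \<sigma>) \<Rightarrow> (map (inv \<tau>) ys', map (inv \<tau>) xs', inv \<tau> \<circ> \<sigma>)) = p"
      by (simp add: pp comp flip: o_assoc) (simp add: comp o_assoc)
    show "(case case p of (ys', xs', \<sigma>) \<Rightarrow> (map (inv \<tau>) ys', map (inv \<tau>) xs', inv \<tau> \<circ> \<sigma>) of 
        (ys', xs', \<sigma>) \<Rightarrow> (map \<tau> ys', map \<tau> xs', \<tau> \<circ> \<sigma>)) = p"
      by (simp add: pp comp flip: o_assoc) (simp add: comp o_assoc)
    show "(case p of (ys', xs', \<sigma>) \<Rightarrow> (map \<tau> ys', map \<tau> xs', \<tau> \<circ> \<sigma>)) \<in> T"
      "(case p of (ys', xs', \<sigma>) \<Rightarrow> (map (inv \<tau>) ys', map (inv \<tau>) xs', inv \<tau> \<circ> \<sigma>)) \<in> T"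
      using p map_L \<tau> \<tau>' by (auto simp: pp T_def permutes_compose)
    show "ev (word (case p of (ys', xs', \<sigma>) \<Rightarrow> (map \<tau> ys', map \<tau> xs', \<tau> \<circ> \<sigma>))) = ev (relabel \<tau> (word p))"
      by (simp add: pp word_def relabel_star relabel_comp fx)
  qed
  have "(\<Sum>p\<in>T. orbit_sum M (word p)) = (\<Sum>\<tau> | \<tau> permutes M. \<Sum>p\<in>T. ev (relabel \<tau> (word p)))"
    unfolding orbit_sum_def by (rule sum.swap)
  also have "\<dots> \<in> A" using inv X_A by (intro A_sum[of "{\<sigma>. \<sigma> permutes M}"]) simp
  finally have total: "(\<Sum>p\<in>T. orbit_sum M (word p)) \<in> A" .
  define good where
    "good = {(ys', xs', \<sigma>) \<in> T. distinct (ys' @ xs') \<and> set (ys' @ xs') \<inter> \<sigma> ` supp v = {}}"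
  have id_good: "(ys, xs, id) \<in> good"
    using nf(1) v_supp lists by (auto simp: good_def T_def permutes_id)
  have good: "orbit_sum M (word p) = orbit_sum M u" if "p \<in> good" for p
  proof -
    obtain ys' xs' \<sigma> where pp: "p = (ys', xs', \<sigma>)" by (cases p)
    have p: "ys' \<in> L ?k" "xs' \<in> L ?l" "\<sigma> permutes M" "distinct (ys' @ xs')" 
        "set (ys' @ xs') \<inter> \<sigma> ` supp v = {}"
      using that by (auto simp: pp good_def T_def)
    define zs zs' where "zs = ys @ xs" and "zs' = ys' @ xs'"
    \<comment> \<open>The relabelling that should turn \<open>u\<close> into \<open>word p\<close>:
      \<sigma> on the points of \<open>v\<close>, and position by position on the star entries.
      Disjointness makes it well defined and injective.\<close>
    define f where "f x = (if x \<in> supp v then \<sigma> x else the (map_of (zip zs zs') x))" for x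
    have len: "length zs = length zs'" using p by (simp add: zs_def zs'_def L_def)
    have f_nth: "f (zs ! i) = zs' ! i" if "i < length zs" for i
    proof -
      have "zs ! i \<notin> supp v" using v_supp that nth_mem[OF that] by (auto simp: zs_def)
      then show ?thesis using that len nf(1) by (simp add: f_def map_of_zip_nth zs_def)
    qed
    have map_f: "map f zs = zs'" using len f_nth by (intro nth_equalityI) auto
    then have f_img: "f ` set zs = set zs'" by (metis set_map)
    have f_v: "f x = \<sigma> x" if "x \<in> supp v" for x using that by (simp add: f_def)
    have "inj_on f (set zs)"
      using map_f p(4) nf(1) by (metis distinct_map zs'_def)
    moreover have "inj_on f (supp v)"
      using f_v permutes_inj_on[OF p(3)] inj_on_cong by metis
    moreover have f_img_v: "f ` supp v = \<sigma> ` supp v" using f_v by (intro image_cong) auto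
    moreover have "set zs' \<inter> \<sigma> ` supp v = {}" using p(5) by (simp add: zs'_def)
    ultimately have "inj_on f (set zs \<union> supp v)"
      using f_img by (subst inj_on_Un) blast
    moreover have "f ` (set zs \<union> supp v) \<subseteq> M"
    proof -
      have "\<sigma> ` supp v \<subseteq> M" using v_supp permutes_image[OF p(3)] by blast
      moreover have "set zs' \<subseteq> M" using p(1,2) by (simp add: zs'_def L_def)
      ultimately show ?thesis by (simp add: image_Un f_img f_img_v)
    qed
    moreover have "set zs \<union> supp v \<subseteq> M" using nf(2) v_supp by (auto simp: zs_def)
    ultimately obtain h where h: "h permutes M" "\<And>x. x \<in> set zs \<union> supp v \<Longrightarrow> h x = f x"
      using ex_permutes_extending[OF M(1)] by metis
    have "map h zs = zs'" using h(2) map_f by (metis UnCI map_cong)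
    then have "map h ys = ys'" "map h xs = xs'"
      using p(1) by (auto simp: zs_def zs'_def L_def)
    moreover have "relabel h v = relabel \<sigma> v" using h(2) f_v by (intro relabel_cong) auto
    moreover have "h a = a" "h b = b" using h(1) M permutes_not_in by metis+
    ultimately have "relabel h u = word p" by (simp add: u_def word_def pp relabel_star)
    then show ?thesis using orbit_sum_relabel[OF h(1)] by metis
  qed
  have bad: "orbit_sum M (word p) \<in> A" if "p \<in> T - good" for p
  proof -
    obtain ys' xs' \<sigma> where pp: "p = (ys', xs', \<sigma>)" by (cases p)
    have p: "ys' \<in> L ?k" "xs' \<in> L ?l" "\<sigma> permutes M" 
        "\<not> distinct (ys' @ xs') \<or> set (ys' @ xs') \<inter> \<sigma> ` supp v \<noteq> {}"
      using that by (auto simp: pp good_def T_def)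
    have "supp (word p) \<inter> M \<subseteq> set (ys' @ xs') \<union> \<sigma> ` supp v"
      using supp_star[of b ys'] supp_star[of a xs'] M by (auto simp: pp word_def supp_relabel)
    then have "card (supp (word p) \<inter> M) \<le> card (set (ys' @ xs') \<union> \<sigma> ` supp v)"
      by (intro card_mono) auto
    \<comment> \<open>A repeated entry makes the set smaller than the list, and a point common to
      stars and \<open>v\<close> is counted once in the union; either way something is lost.\<close>
    also have "\<dots> < ?k + ?l + card (supp v)"
    proof -
      have l: "length (ys' @ xs') = ?k + ?l" using p by (simp add: L_def)
      have c: "card (set (ys' @ xs')) \<le> ?k + ?l" using card_length[of "ys' @ xs'"] l by simp
      have i: "card (\<sigma> ` supp v) \<le> card (supp v)" by (intro card_image_le) simp
      have un: "card (set (ys' @ xs') \<union> \<sigma> ` supp v) + card (set (ys' @ xs') \<inter> \<sigma> ` supp v) =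
          card (set (ys' @ xs')) + card (\<sigma> ` supp v)"
        by (intro card_Un_Int[symmetric]) auto
      from p(4) show ?thesis
      proof
        assume "\<not> distinct (ys' @ xs')"
        then have "card (set (ys' @ xs')) \<noteq> ?k + ?l" using card_distinct l by metis
        then show ?thesis using c i un by linarith
      next
        assume "set (ys' @ xs') \<inter> \<sigma> ` supp v \<noteq> {}"
        then have "card (set (ys' @ xs') \<inter> \<sigma> ` supp v) > 0" by (simp add: card_gt_0_iff)
        then show ?thesis using c i un by linarith
      qed
    qed
    also have "\<dots> = card (set (ys @ xs) \<union> supp v)"
      using v_supp distinct_card[OF nf(1)] by (subst card_Un_disjoint) auto
    also have "\<dots> \<le> card ?U" using v_supp nf(2) M(1) by (intro card_mono) auto
    finally show ?thesis using less.hyps word_I that by blast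
  qed
  have "good \<subseteq> T" by (auto simp: good_def)
  then have "(\<Sum>p\<in>T. orbit_sum M (word p)) = (\<Sum>p\<in>good. orbit_sum M u) + (\<Sum>p\<in>T - good. orbit_sum M (word p))"
    using fin_T good by (subst sum.subset_diff[of good T]) (auto simp: add.commute)
  then have "(\<Sum>p\<in>good. orbit_sum M u) = (\<Sum>p\<in>T. orbit_sum M (word p)) + - (\<Sum>p\<in>T - good. orbit_sum M (word p))"
    by simp
  also have "\<dots> \<in> A" by (intro A_add A_minus total A_sum[of "T - good"] bad)
  finally have sum_good: "(\<Sum>p\<in>good. orbit_sum M u) \<in> A" .
  \<comment> \<open>The number of good triples is only known to be positive, by
    \<open>id_good\<close>. The index set in \<open>A_div\<close> has exactly the type of
    \<open>good\<close>, as an assumption cannot be polymorphic.\<close>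
  have "finite good" "good \<noteq> {}" using id_good fin_T \<open>good \<subseteq> T\<close> finite_subset by auto
  then have "orbit_sum M u \<in> A" using e_orbit_sum[OF MI uI] sum_good by (rule A_div)
  then have "orbit_sum M (u @ (if \<epsilon> then [(a, b)] else [])) \<in> A"
    using uI orbit_sum_snoc_fixed[OF MI uI, of a b] M ab A_ab A_mult by simp
  then show ?case
    using orbit_sum_word_eq[OF M(1) MI nf(4)] A_minus unfolding u_def by auto
qed

end

section \<open>The supercentralizer\<close>

lemma K_eqv: "eqv n x y \<Longrightarrow> K n x = K n y"
  using K_eq eqv_wf by blast

lemma K_scal_central: "wf n x \<Longrightarrow> K n (Scal c) * K n x = K n x * K n (Scal c)"
  using K_eqv[OF eqv.scal_central, of n x c] by (simp add: K_mul)

lemma K_scal_mult: "K n (Scal c) * K n (Scal d) = K n (Scal (c * d))"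
  using K_eqv[OF eqv.scal_mul, of n c d] by (simp add: K_mul)

lemma K_scal_add: "K n (Scal c) + K n (Scal d) = K n (Scal (c + d))"
  using K_eqv[OF eqv.scal_add, of n c d] by (simp add: K_add)

lemma K_one_l: "wf n x \<Longrightarrow> K n (Scal 1) * K n x = K n x"
  and K_one_r: "wf n x \<Longrightarrow> K n x * K n (Scal 1) = K n x"
  using K_eqv[OF eqv.mul_one_l, of n x] K_eqv[OF eqv.mul_one_r, of n x] by (simp_all add: K_mul)

lemma K_minus_one: "K n (Scal (-1)) = - K n (Scal 1)"
  using K_neg[of n "Scal 1"] by (simp add: neg_def K_mul K_scal_mult)

interpretation gens: spin_gens n "\<lambda>k. K n (Gen k)" "K n (Scal 1)" for n
proof
  let ?e = "K n (Scal 1)"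
  show "?e * ?e = ?e" by (simp add: K_scal_mult)
  fix k
  show "?e * K n (Gen k) = K n (Gen k)" "K n (Gen k) * ?e = K n (Gen k)" if "k \<in> {1..<n}"
    using that by (simp_all add: K_one_l K_one_r)
  have sq: "K n (Gen k) * K n (Gen k) = ?e" if "k \<in> {1..<n}" for k
    using that K_eqv[OF eqv.rel_sq, of k n] by (simp add: K_mul)
  then show "K n (Gen k) * K n (Gen k) = ?e" if "k \<in> {1..<n}" using that by blast
  show "K n (Gen k) * K n (Gen (k + 1)) * K n (Gen k) =
      K n (Gen (k + 1)) * K n (Gen k) * K n (Gen (k + 1))" if "1 \<le> k" "k + 1 < n"
  proof -
    define g h where "g = K n (Gen k)" and "h = K n (Gen (k + 1))"
    have w: "wf n (Gen k)" "wf n (Gen (k + 1))" using that by auto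
    have gg: "g * g = ?e" "h * h = ?e" using sq that by (auto simp: g_def h_def)
    have e: "?e * g = g" "g * ?e = g" "?e * h = h" "h * ?e = h"
      using w by (simp_all add: g_def h_def K_one_l K_one_r)
    have "g * h * (g * h * (g * h)) = ?e"
      using K_eqv[OF eqv.rel_braid[OF that]] w by (simp add: pow3_def K_mul g_def h_def)
    \<comment> \<open>Multiply by the cube of \<open>g * h\<close>, which is the unit, and let the
      squares cancel from the middle outwards. The square of \<open>g * h\<close> is used in the
      same way for distant generators.\<close>
    then have "h * g * h = g * h * (g * h * (g * h)) * (h * g * h)"
      by (simp add: e flip: mult.assoc)
    also have "\<dots> = g * h * g * (h * (g * (h * h) * g) * h)" by (simp add: mult.assoc)
    also have "\<dots> = g * h * g" by (simp add: gg e) (simp add: mult.assoc gg e)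
    finally show ?thesis by (simp add: g_def h_def)
  qed
  show "K n (Gen k) * K n (Gen l) = - (K n (Gen l) * K n (Gen k))"
    if "k \<in> {1..<n}" "l \<in> {1..<n}" "k + 1 < l \<or> l + 1 < k" for l
  proof -
    define g h where "g = K n (Gen k)" and "h = K n (Gen l)"
    have w: "wf n (Gen k)" "wf n (Gen l)" using that by auto
    have gg: "g * g = ?e" "h * h = ?e" using sq that by (auto simp: g_def h_def)
    have e: "?e * g = g" "g * ?e = g" "?e * h = h" "h * ?e = h"
      using w by (simp_all add: g_def h_def K_one_l K_one_r)
    have "g * h * (g * h) = - ?e"
      using K_eqv[OF eqv.rel_far, of k l n] that w by (simp add: K_mul g_def h_def K_minus_one)
    then have "- (h * g) = g * h * (g * h) * (h * g)" by (simp add: e flip: mult.assoc)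
    also have "\<dots> = g * h * (g * (h * h) * g)" by (simp add: mult.assoc)
    also have "\<dots> = g * h" by (simp add: gg e) (simp add: mult.assoc gg e)
    finally show ?thesis by (simp add: g_def h_def)
  qed
qed

abbreviation tK :: "nat \<Rightarrow> nat \<Rightarrow> nat \<Rightarrow> R" where
  "tK \<equiv> gens.t"

interpretation word: spin_words "{1..n}" "tK n" "K n (Scal 1)" for n
  using gens.unital_t[of _ n, unfolded gens.unital_def]
  by unfold_locales (auto simp: gens.e_idem gens.t_sq gens.t_conj)

section \<open>Terms that represent words, and their parity\<close>

lemma tau_rec_wf: "1 \<le> i \<Longrightarrow> i + d < n \<Longrightarrow> wf n (tau_rec i d)"
  by (induction d) auto

lemma tr_eq: "1 \<le> i \<Longrightarrow> i + d < n \<Longrightarrow> gens.tr n i d = K n (tau_rec i d)"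
  by (induction d) (auto simp: K_neg K_mul tau_rec_wf)

lemma tau_wf: "1 \<le> i \<Longrightarrow> i < j \<Longrightarrow> j \<le> n \<Longrightarrow> wf n (tau i j)"
  by (simp add: tau_def tau_rec_wf)

lemma K_tau: "1 \<le> i \<Longrightarrow> i < j \<Longrightarrow> j \<le> n \<Longrightarrow> K n (tau i j) = tK n i j"
  by (simp add: tau_def gens.t_def tr_eq)

text \<open>\<open>tau i j\<close> is the intended element only for \<open>i < j\<close>; otherwise
  truncated subtraction makes it \<open>Gen i\<close>.\<close>

definition tau_alt :: "nat \<Rightarrow> nat \<Rightarrow> fexp" where
  "tau_alt i j = (if i < j then tau i j else neg (tau j i))"

definition word_term :: "(nat \<times> nat) list \<Rightarrow> fexp" where
  "word_term w = foldr (\<lambda>(i, j) x. Mul (tau_alt i j) x) w (Scal 1)"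

lemma word_term_simps [simp]:
  "word_term [] = Scal 1" "word_term ((i, j) # w) = Mul (tau_alt i j) (word_term w)"
  by (simp_all add: word_term_def)

lemma tau_alt_wf: "i \<in> {1..n} \<Longrightarrow> j \<in> {1..n} \<Longrightarrow> i \<noteq> j \<Longrightarrow> wf n (tau_alt i j)"
  by (auto simp: tau_alt_def intro!: tau_wf)

lemma K_tau_alt: "i \<in> {1..n} \<Longrightarrow> j \<in> {1..n} \<Longrightarrow> i \<noteq> j \<Longrightarrow> K n (tau_alt i j) = tK n i j"
  using gens.t_swap[of j i n] by (auto simp: tau_alt_def K_neg tau_wf K_tau)

lemma word_term_wf: "w \<in> words {1..n} \<Longrightarrow> wf n (word_term w)"
  by (induction w) (auto simp: tau_alt_wf)

lemma K_word_term: "w \<in> words {1..n} \<Longrightarrow> K n (word_term w) = word.ev n w"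
  by (induction w) (auto simp: tau_alt_wf word_term_wf K_mul K_tau_alt)

lemma hom_Mul: "hom p x \<Longrightarrow> hom q y \<Longrightarrow> r = (p \<noteq> q) \<Longrightarrow> hom r (Mul x y)"
  using hom.intros(4) by blast

lemma hom_neg: "hom p x \<Longrightarrow> hom p (neg x)"
  unfolding neg_def by (rule hom_Mul[OF hom.intros(2)]) auto

lemma hom_tau: "hom True (tau i j)"
proof -
  have "hom True (tau_rec i d)" for d
    by (induction d) (auto intro!: hom_neg hom.intros(1) intro: hom_Mul)
  then show ?thesis by (simp add: tau_def)
qed

lemma hom_word_term: "hom (odd (length w)) (word_term w)"
proof (induction w)
  case (Cons p w)
  obtain i j where p: "p = (i, j)" by fastforce
  have "hom True (tau_alt i j)" by (simp add: tau_alt_def hom_tau hom_neg)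
  then show ?case using Cons by (auto simp: p intro: hom_Mul)
qed (simp add: hom.intros(2))

lemma homog_hom: "wf n x \<Longrightarrow> hom p x \<Longrightarrow> homog n p x"
  unfolding homog_def using eqv.refl by blast

lemma homog_wf: "homog n p x \<Longrightarrow> wf n x"
  by (simp add: homog_def)

lemma homog_eqv: "homog n p x \<Longrightarrow> eqv n x y \<Longrightarrow> homog n p y"
  unfolding homog_def using eqv.sym eqv.trans eqv_wf by blast

lemma homog_Add: "homog n p x \<Longrightarrow> homog n p y \<Longrightarrow> homog n p (Add x y)"
  unfolding homog_def using eqv.add_cong hom.intros(3) by fastforce

lemma homog_Mul: "homog n p x \<Longrightarrow> homog n q y \<Longrightarrow> homog n (p \<noteq> q) (Mul x y)"
  unfolding homog_def using eqv.mul_cong hom.intros(4) by fastforce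

lemma homog_mono: "homog m p x \<Longrightarrow> m \<le> n \<Longrightarrow> homog n p x"
  unfolding homog_def using eqv_mono wf_mono by blast

lemma fsum_simps [simp]: "fsum [] = Scal 0" "fsum (x # xs) = Add x (fsum xs)"
  by (simp_all add: fsum_def)

lemma fsum_wf: "(\<And>x. x \<in> set xs \<Longrightarrow> wf n x) \<Longrightarrow> wf n (fsum xs)"
  by (induction xs) auto

lemma K_fsum: "(\<And>x. x \<in> set xs \<Longrightarrow> wf n x) \<Longrightarrow> K n (fsum xs) = sum_list (map (K n) xs)"
  by (induction xs) (auto simp: K_zero K_add fsum_wf)

text \<open>\<open>fsum\<close> ends in \<open>Scal 0\<close>, which is even as a term, hence the restriction to nonempty lists.\<close>

lemma homog_fsum: "xs \<noteq> [] \<Longrightarrow> (\<And>x. x \<in> set xs \<Longrightarrow> homog n p x) \<Longrightarrow> homog n p (fsum xs)"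
proof (induction xs rule: list_nonempty_induct)
  case (single x)
  then show ?case using homog_eqv[of n p x] eqv.sym[OF eqv.add_zero] homog_wf by auto
qed (auto intro: homog_Add)

section \<open>Reduction of supercommutation to generators, and closure of \<open>SZ\<close> under
  products\<close>

lemma supercommute_hom:
  assumes "m \<le> n" "wf n z"
    and gen: "\<And>k. k \<in> {1..<m} \<Longrightarrow> K n z * K n (Gen k) = sg p (K n (Gen k) * K n z)"
    and "hom q b" "wf m b"
  shows "K n z * K n b = sg (p \<and> q) (K n b * K n z)"
  using assms(4,5)
proof (induction rule: hom.induct)
  case (1 k)
  then show ?case using gen by simp
next
  case (2 c)
  then show ?case using K_scal_central assms(2) by simp
next
  case (3 q x y)
  then show ?case using wf_mono[of m _ n] assms(1) by (simp add: K_add distrib_left distrib_right)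
next
  case (4 q x r y)
  then have w: "wf n x" "wf n y" using wf_mono assms(1) by auto
  have "K n z * K n (Mul x y) = (K n z * K n x) * K n y" using w by (simp add: K_mul mult.assoc)
  also have "\<dots> = sg (p \<and> q) (K n x * (K n z * K n y))" using 4 by (simp add: sg_mult mult.assoc)
  \<comment> \<open>The signs of the two factors combine by distributivity modulo 2: pq + pr = p(q +
    r).\<close>
  also have "\<dots> = sg (p \<and> (q \<noteq> r)) (K n (Mul x y) * K n z)"
    using 4 w by (auto simp: sg_mult mult.assoc K_mul sg_def)
  finally show ?case .
qed

lemma sz_hom_iff:
  assumes "m \<le> n"
  shows "z \<in> sz_hom n m \<longleftrightarrow> (\<exists>p. homog n p z \<and>
    (\<forall>k \<in> {1..<m}. K n z * K n (Gen k) = sg p (K n (Gen k) * K n z)))"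
proof (intro iffI)
  assume "z \<in> sz_hom n m"
  then obtain p where p: "homog n p z" "\<And>b q. wf m b \<Longrightarrow> homog m q b \<Longrightarrow>
      eqv n (Mul z b) (if p \<and> q then neg (Mul b z) else Mul b z)"
    unfolding sz_hom_def by blast
  have "K n z * K n (Gen k) = sg p (K n (Gen k) * K n z)" if "k \<in> {1..<m}" for k
  proof -
    have wk: "wf m (Gen k)" "wf n (Gen k)" "wf n z"
      using that assms p(1) homog_wf by auto
    moreover have "homog m True (Gen k)" using wk(1) hom.intros(1) by (rule homog_hom)
    ultimately
    show ?thesis using K_eqv[OF p(2), of "Gen k" True]
      by (auto simp: K_mul K_neg sg_def split: if_splits)
  qed
  then show "\<exists>p. homog n p z \<and> (\<forall>k \<in> {1..<m}. K n z * K n (Gen k) = sg p (K n (Gen k) * K n z))"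
    using p(1) by blast
next
  assume "\<exists>p. homog n p z \<and> (\<forall>k \<in> {1..<m}. K n z * K n (Gen k) = sg p (K n (Gen k) * K n z))"
  then obtain p where p: "homog n p z"
    "\<And>k. k \<in> {1..<m} \<Longrightarrow> K n z * K n (Gen k) = sg p (K n (Gen k) * K n z)" by blast
  have z: "wf n z" using p(1) homog_wf by blast
  have "eqv n (Mul z b) (if p \<and> q then neg (Mul b z) else Mul b z)" if b: "wf m b" "homog m q b" for b q
  proof -
    obtain y where y: "hom q y" "eqv m b y" using b(2) by (auto simp: homog_def)
    have "K n z * K n y = sg (p \<and> q) (K n y * K n z)"
      using supercommute_hom[OF assms z p(2) y(1)] eqv_wf[OF y(2)] by simp
    moreover have "K n y = K n b" using K_eqv eqv_mono[OF y(2) assms] by metis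
    moreover have "wf n b" using b(1) assms wf_mono by blast
    ultimately show ?thesis using z
      by (auto simp: sg_def K_mul K_neg simp flip: K_eq)
  qed
  then show "z \<in> sz_hom n m" unfolding sz_hom_def using p(1) by blast
qed

lemma lin_span_wf: "(\<And>s. s \<in> S \<Longrightarrow> wf n s) \<Longrightarrow> x \<in> lin_span n S \<Longrightarrow> wf n x"
  by (rotate_tac, induction rule: lin_span.induct) (auto dest: eqv_wf)

lemma SZ_wf: "x \<in> SZ n m \<Longrightarrow> wf n x"
  unfolding SZ_def by (rule lin_span_wf[rotated]) (auto simp: sz_hom_def homog_def)

lemma SZ_K: "x \<in> SZ n m \<Longrightarrow> wf n y \<Longrightarrow> K n x = K n y \<Longrightarrow> y \<in> SZ n m"
  using SZ_wf K_eq unfolding SZ_def by (blast intro: lin_span.intros(5))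

lemma SZ_zero: "Scal 0 \<in> SZ n m"
  and SZ_sz_hom: "s \<in> sz_hom n m \<Longrightarrow> s \<in> SZ n m"
  and SZ_Add: "x \<in> SZ n m \<Longrightarrow> y \<in> SZ n m \<Longrightarrow> Add x y \<in> SZ n m"
  and SZ_scale: "x \<in> SZ n m \<Longrightarrow> Mul (Scal c) x \<in> SZ n m"
  unfolding SZ_def by (auto intro: lin_span.intros)

lemma SZ_induct [consumes 1, case_names zero base add scale eqv]:
  assumes "x \<in> SZ n m" "P (Scal 0)" "\<And>s. s \<in> sz_hom n m \<Longrightarrow> P s"
    "\<And>x y. x \<in> SZ n m \<Longrightarrow> P x \<Longrightarrow> y \<in> SZ n m \<Longrightarrow> P y \<Longrightarrow> P (Add x y)"
    "\<And>c x. x \<in> SZ n m \<Longrightarrow> P x \<Longrightarrow> P (Mul (Scal c) x)"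
    "\<And>x y. x \<in> SZ n m \<Longrightarrow> P x \<Longrightarrow> eqv n x y \<Longrightarrow> P y"
  shows "P x"
  using assms unfolding SZ_def by (rule lin_span.induct)

lemma sz_hom_Mul:
  assumes "m \<le> n" "x \<in> sz_hom n m" "y \<in> sz_hom n m"
  shows "Mul x y \<in> sz_hom n m"
proof -
  obtain p where p: "homog n p x"
    "\<And>k. k \<in> {1..<m} \<Longrightarrow> K n x * K n (Gen k) = sg p (K n (Gen k) * K n x)"
    using assms sz_hom_iff by metis
  obtain q where q: "homog n q y"
    "\<And>k. k \<in> {1..<m} \<Longrightarrow> K n y * K n (Gen k) = sg q (K n (Gen k) * K n y)"
    using assms sz_hom_iff by metis
  have "K n (Mul x y) * K n (Gen k) = sg (p \<noteq> q) (K n (Gen k) * K n (Mul x y))"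
    if "k \<in> {1..<m}" for k
  proof -
    have "K n (Mul x y) * K n (Gen k) = K n x * (K n y * K n (Gen k))"
      using p(1) q(1) by (simp add: K_mul homog_wf mult.assoc)
    also have "\<dots> = sg q ((K n x * K n (Gen k)) * K n y)"
      using q(2)[OF that] by (simp add: sg_mult mult.assoc)
    also have "\<dots> = sg (p \<noteq> q) (K n (Gen k) * K n (Mul x y))"
      using p(2)[OF that] p(1) q(1) by (auto simp: sg_mult K_mul homog_wf mult.assoc sg_def)
    finally show ?thesis .
  qed
  then show ?thesis using homog_Mul[OF p(1) q(1)] assms(1) sz_hom_iff by blast
qed

lemma SZ_Mul:
  assumes "m \<le> n" "x \<in> SZ n m" "y \<in> SZ n m"
  shows "Mul x y \<in> SZ n m"
  using assms(2)
proof (induction rule: SZ_induct)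
  case zero
  show ?case using SZ_zero by (rule SZ_K) (use assms SZ_wf in \<open>auto simp: K_mul K_zero\<close>)
next
  case (base s)
  have s: "wf n s" using base SZ_sz_hom SZ_wf by blast
  show ?case using assms(3)
  proof (induction rule: SZ_induct)
    case zero
    show ?case using SZ_zero by (rule SZ_K) (use s in \<open>auto simp: K_mul K_zero\<close>)
  next
    case (base s')
    then show ?case using sz_hom_Mul[OF assms(1) \<open>s \<in> sz_hom n m\<close>] SZ_sz_hom by blast
  next
    case (add x y)
    show ?case using SZ_Add[OF add.IH]
      by (rule SZ_K) (use s add SZ_wf in \<open>auto simp: K_mul K_add distrib_left\<close>)
  next
    case (scale c x)
    show ?case using SZ_scale[OF scale.IH, of c]
    proof (rule SZ_K)
      show "K n (Mul (Scal c) (Mul s x)) = K n (Mul s (Mul (Scal c) x))"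
        using s scale SZ_wf[OF scale.hyps] K_scal_central[OF s, of c]
        by (simp add: K_mul flip: mult.assoc)
    qed (use s scale SZ_wf in auto)
  next
    case (eqv x y)
    show ?case using eqv.IH
      by (rule SZ_K) (use s eqv eqv_wf[OF eqv.hyps(2)] K_eqv in \<open>auto simp: K_mul\<close>)
  qed
next
  case (add x1 x2)
  show ?case using SZ_Add[OF add.IH]
    by (rule SZ_K) (use assms add SZ_wf in \<open>auto simp: K_mul K_add distrib_right\<close>)
next
  case (scale c x)
  show ?case using SZ_scale[OF scale.IH, of c]
    by (rule SZ_K) (use assms scale SZ_wf in \<open>auto simp: K_mul mult.assoc\<close>)
next
  case (eqv x1 x2)
  show ?case using eqv.IH
    by (rule SZ_K) (use assms(3) SZ_wf eqv eqv_wf[OF eqv.hyps(2)] K_eqv in \<open>auto simp: K_mul\<close>)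
qed

lemma SZ_mono:
  assumes "m \<le> n" "x \<in> SZ m m"
  shows "x \<in> SZ n m"
  using assms(2)
proof (induction rule: SZ_induct)
  case (base s)
  then have "s \<in> sz_hom n m"
    using homog_mono eqv_mono assms(1) unfolding sz_hom_def by (smt (verit, best) mem_Collect_eq)
  then show ?case by (rule SZ_sz_hom)
next
  case (eqv x y)
  then show ?case using eqv_mono[OF _ assms(1)] unfolding SZ_def by (blast intro: lin_span.intros(5))
qed (auto intro: SZ_zero SZ_Add SZ_scale)

lemma Scal_in_sz_hom: "m \<le> n \<Longrightarrow> Scal c \<in> sz_hom n m"
  using sz_hom_iff[of m n "Scal c"] K_scal_central[of n "Gen _" c] hom.intros(2) homog_hom[of n "Scal c" False]
  by (fastforce)

section \<open>The generators lie in the supercentralizer\<close>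

lemma pi_wf: "k \<le> n \<Longrightarrow> wf n (pi k)"
  unfolding pi_def by (intro fsum_wf) (auto intro!: tau_wf)

lemma K_pi: "k \<le> n \<Longrightarrow> K n (pi k) = (\<Sum>i\<in>{1..<k}. tK n i k)"
proof -
  assume k: "k \<le> n"
  have "K n (pi k) = sum_list (map (\<lambda>i. K n (tau i k)) [1..<k])"
    unfolding pi_def using k by (subst K_fsum) (auto simp: o_def intro!: tau_wf)
  also have "\<dots> = (\<Sum>i\<in>{1..<k}. K n (tau i k))"
    by (simp add: sum_list_distinct_conv_sum_set)
  finally show ?thesis using k by (simp add: K_tau)
qed

lemma conj_imp_supercommute:
  assumes "K n g * x * K n g = sg p x" "K n g * K n g = K n (Scal 1)" "K n (Scal 1) * x = x"
  shows "x * K n g = sg p (K n g * x)"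
proof -
  have "x * K n g = K n g * (K n g * x * K n g)"
    using assms(2,3) by (simp flip: mult.assoc)
  then show ?thesis using assms(1) by (simp add: sg_mult)
qed

text \<open>Conjugation by \<open>Gen l\<close> with \<open>l < m\<close> fixes the index
  \<open>k\<close> and permutes the summands up to a common sign. With \<open>2 \<le> k\<close> the
  sum is nonempty, as \<open>homog_fsum\<close> demands.\<close>

lemma pi_in_sz_hom:
  assumes "2 \<le> k" "k \<le> n" "m < k"
  shows "pi k \<in> sz_hom n m"
proof -
  have "homog n True (pi k)" unfolding pi_def
    using assms by (intro homog_fsum) (auto intro!: homog_hom hom_tau tau_wf)
  moreover have "K n (pi k) * K n (Gen l) = sg True (K n (Gen l) * K n (pi k))"
    if l: "l \<in> {1..<m}" for l
  proof (rule conj_imp_supercommute)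
    let ?s = "transpose l (Suc l)"
    have "K n (Gen l) * K n (pi k) * K n (Gen l) =
        (\<Sum>i\<in>{1..<k}. K n (Gen l) * tK n i k * K n (Gen l))"
      using assms by (simp add: K_pi sum_distrib_left sum_distrib_right)
    also have "\<dots> = (\<Sum>i\<in>{1..<k}. - tK n (?s i) k)"
      using l assms by (intro sum.cong HOL.refl) (auto simp: gens.conj_g transpose_def)
    also have "\<dots> = - (\<Sum>i\<in>{1..<k}. tK n i k)"
      unfolding sum_negf
      by (rule arg_cong[of _ _ uminus], rule sum.reindex_bij_witness[of _ ?s ?s])
         (use l assms in \<open>auto simp: transpose_def\<close>)
    finally show "K n (Gen l) * K n (pi k) * K n (Gen l) = sg True (K n (pi k))"
      using assms by (simp add: K_pi)
  qed (use l assms in \<open>simp_all add: gens.g_sq K_one_l pi_wf\<close>)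
  ultimately show ?thesis using assms sz_hom_iff[of m n] by auto
qed

lemma Gen_in_sz_hom:
  assumes "m < k" "1 \<le> k" "k < n"
  shows "Gen k \<in> sz_hom n m"
proof -
  have "homog n True (Gen k)" using assms by (intro homog_hom hom.intros) auto
  moreover have "K n (Gen k) * K n (Gen l) = sg True (K n (Gen l) * K n (Gen k))"
    if "l \<in> {1..<m}" for l
    using gens.g_far[of k n l] that assms by simp
  ultimately show ?thesis using assms sz_hom_iff[of m n] by auto
qed

text \<open>One term has to serve two algebras: its supercentrality is checked in A_m, while its
  value is needed in A_n.\<close>

lemma orbit_sum_in_SZ:
  assumes v: "v \<in> words {1..m}"
  obtains z where "z \<in> SZ m m" "\<And>n. m \<le> n \<Longrightarrow> K n z = word.orbit_sum n {1..m} v"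
proof -
  let ?P = "{\<sigma>. \<sigma> permutes {1..m}}"
  obtain ps where ps: "set ps = ?P" "distinct ps"
    using finite_distinct_list[OF finite_permutations[of "{1..m}"]] by auto
  define z where "z = fsum (map (\<lambda>\<sigma>. word_term (relabel \<sigma> v)) ps)"
  have w: "relabel \<sigma> v \<in> words {1..n}" if "\<sigma> \<in> ?P" "m \<le> n" for \<sigma> n
    using that v relabel_words[of \<sigma> "{1..m}" "{1..m}" v] by (auto elim!: words_mono)
  have K: "K n z = word.orbit_sum n {1..m} v" if "m \<le> n" for n
  proof -
    have "K n z = sum_list (map (\<lambda>\<sigma>. K n (word_term (relabel \<sigma> v))) ps)"
      unfolding z_def using w that ps by (subst K_fsum) (auto simp: o_def intro!: word_term_wf)
    also have "\<dots> = (\<Sum>\<sigma>\<in>?P. K n (word_term (relabel \<sigma> v)))"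
      using ps by (simp add: sum_list_distinct_conv_sum_set)
    finally show ?thesis using w that by (simp add: word.orbit_sum_def K_word_term)
  qed
  have h: "homog m (odd (length v)) (word_term (relabel \<sigma> v))" if "\<sigma> \<in> ?P" for \<sigma>
    using hom_word_term[of "relabel \<sigma> v"] word_term_wf w[OF that] by (intro homog_hom) auto
  have "id \<in> ?P" by (simp add: permutes_id)
  then have "ps \<noteq> []" using ps(1) by (metis empty_iff set_empty)
  then have hz: "homog m (odd (length v)) z"
    unfolding z_def using h by (intro homog_fsum) (auto simp: ps(1))
  have "K m z * K m (Gen k) = sg (odd (length v)) (K m (Gen k) * K m z)" if k: "k \<in> {1..<m}" for k
  proof (rule conj_imp_supercommute)
    show "K m (Gen k) * K m z * K m (Gen k) = sg (odd (length v)) (K m z)"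
      using word.orbit_sum_conj[of "{1..m}" m k "Suc k" v] k v by (simp add: K gens.t_Suc)
  qed (use k hz homog_wf in \<open>auto simp: gens.g_sq K_one_l\<close>)
  then have "z \<in> SZ m m" using hz sz_hom_iff[of m m z] SZ_sz_hom by blast
  then show ?thesis using that K by blast
qed

section \<open>Averaging over the symmetric group\<close>

inductive_set word_span :: "nat \<Rightarrow> bool \<Rightarrow> R set" for n p where
  word: "w \<in> words {1..n} \<Longrightarrow> odd (length w) = p \<Longrightarrow> word.ev n w \<in> word_span n p"
| add: "x \<in> word_span n p \<Longrightarrow> y \<in> word_span n p \<Longrightarrow> x + y \<in> word_span n p"
| scale: "x \<in> word_span n p \<Longrightarrow> K n (Scal c) * x \<in> word_span n p"

lemma ev_scal_commute: "w \<in> words {1..n} \<Longrightarrow> word.ev n w * (K n (Scal c) * x) = K n (Scal c) * (word.ev n w * x)"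
  using K_scal_central[of n "word_term w" c] by (simp add: word_term_wf K_word_term flip: mult.assoc)

lemma word_span_mult:
  assumes "x \<in> word_span n p" "y \<in> word_span n q"
  shows "x * y \<in> word_span n (p \<noteq> q)"
  using assms(1)
proof (induction rule: word_span.induct)
  case (word u)
  show ?case using assms(2)
  proof (induction rule: word_span.induct)
    case (word v)
    show ?case using \<open>u \<in> _\<close> \<open>odd (length u) = p\<close> word
      using word_span.word[of "u @ v" n "p \<noteq> q"] by (auto simp: word.ev_append)
  next
    case (scale y c)
    then show ?case using \<open>u \<in> _\<close> by (simp add: ev_scal_commute word_span.scale)
  qed (simp add: distrib_left word_span.add)
next
  case (scale x c)
  then show ?case by (simp add: mult.assoc word_span.scale)
qed (simp add: distrib_right word_span.add)

text \<open>Here the words are seen to span the algebra. Parity is tracked because the averaging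
  below uses one sign for a whole homogeneous element.\<close>

lemma hom_word_span: "hom p y \<Longrightarrow> wf n y \<Longrightarrow> K n y \<in> word_span n p"
proof (induction rule: hom.induct)
  case (1 k)
  then have "word.ev n [(k, Suc k)] = K n (Gen k)"
    by (simp add: gens.t_Suc K_one_r)
  then show ?case using word_span.word[of "[(k, Suc k)]" n True] 1 by simp
next
  case (2 c)
  then show ?case using word_span.scale[OF word_span.word[of "[]" n False], of c]
    by (simp add: K_one_r)
next
  case (3 p x y)
  then show ?case by (simp add: K_add word_span.add)
next
  case (4 p x q y)
  then show ?case using word_span_mult by (simp add: K_mul)
qed

lemma sum_const_scal:
  "finite S \<Longrightarrow> K n (Scal 1) * x = x \<Longrightarrow> (\<Sum>i\<in>S. x) = K n (Scal (of_nat (card S))) * x"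
  by (induction S rule: finite_induct) (auto simp: K_zero distrib_right simp flip: K_scal_add)

lemma sum_const_div:
  assumes "finite S" "S \<noteq> {}" "K n (Scal 1) * x = x"
  shows "x = K n (Scal (1 / of_nat (card S))) * (\<Sum>i\<in>S. x)"
  using assms by (simp add: sum_const_scal K_scal_mult card_eq_0_iff flip: mult.assoc)

text \<open>\<open>av\<close> is the averaging operator without division by the group order. It
  sends a word to its orbit sum, but multiplies \<open>K n z\<close> by the group order, since
  \<open>z\<close> supercommutes with every lift \<open>G \<sigma>\<close>.\<close>

lemma sz_hom_in_subalgebra:
  fixes A :: "R set"
  assumes mn: "m \<le> n"
    and A_add: "\<And>x y. x \<in> A \<Longrightarrow> y \<in> A \<Longrightarrow> x + y \<in> A"
    and A_scale: "\<And>c x. x \<in> A \<Longrightarrow> K n (Scal c) * x \<in> A" and A_0: "0 \<in> A"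
    and A_orbit: "\<And>w. w \<in> words {1..n} \<Longrightarrow> word.orbit_sum n {1..m} w \<in> A"
    and z: "z \<in> sz_hom n m"
  shows "K n z \<in> A"
proof -
  let ?P = "{\<sigma>. \<sigma> permutes {1..m}}"
  obtain p where p: "homog n p z"
    "\<And>k. k \<in> {1..<m} \<Longrightarrow> K n z * K n (Gen k) = sg p (K n (Gen k) * K n z)"
    using sz_hom_iff[OF mn] z by blast
  have sub: "{1..m} \<subseteq> {1..n}" using mn by auto
  have "\<forall>\<sigma>\<in>?P. \<exists>g \<in> words {1..m}. \<forall>w \<in> words {1..n}. word.ev n g * word.ev n w * word.ev n (rev g) =
      sg (odd (length g) \<and> odd (length w)) (word.ev n (relabel \<sigma> w))"
    using word.ex_lift[OF _ _ sub] by blast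
  then obtain G where G: "\<And>\<sigma>. \<sigma> \<in> ?P \<Longrightarrow> G \<sigma> \<in> words {1..m}"
    "\<And>\<sigma> w. \<sigma> \<in> ?P \<Longrightarrow> w \<in> words {1..n} \<Longrightarrow> word.ev n (G \<sigma>) * word.ev n w * word.ev n (rev (G \<sigma>)) =
      sg (odd (length (G \<sigma>)) \<and> odd (length w)) (word.ev n (relabel \<sigma> w))"
    by metis
  have Gn: "G \<sigma> \<in> words {1..n}" if "\<sigma> \<in> ?P" for \<sigma> using G(1)[OF that] sub words_mono by blast
  \<comment> \<open>On elements of parity \<open>p\<close> this sign turns conjugation by a lift
    into the action that relabels words.\<close>
  define av where "av x = (\<Sum>\<sigma>\<in>?P. sg (odd (length (G \<sigma>)) \<and> p)
      (word.ev n (G \<sigma>) * x * word.ev n (rev (G \<sigma>))))" for x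
  have av_span: "av x \<in> A" if "x \<in> word_span n p" for x
    using that
  proof (induction rule: word_span.induct)
    case (word w)
    then have "av (word.ev n w) = word.orbit_sum n {1..m} w"
      unfolding av_def word.orbit_sum_def by (intro sum.cong HOL.refl) (auto simp: G(2))
    then show ?case using A_orbit word by simp
  next
    case (add x y)
    have "av (x + y) = av x + av y"
      by (simp add: av_def distrib_left distrib_right sum.distrib)
    then show ?case using add A_add by simp
  next
    case (scale x c)
    have "av (K n (Scal c) * x) = K n (Scal c) * av x"
      unfolding av_def sum_distrib_left
    proof (rule sum.cong[OF HOL.refl])
      fix \<sigma> assume "\<sigma> \<in> ?P"
      then show "sg (odd (length (G \<sigma>)) \<and> p) (word.ev n (G \<sigma>) * (K n (Scal c) * x) * word.ev n (rev (G \<sigma>))) =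
          K n (Scal c) * sg (odd (length (G \<sigma>)) \<and> p) (word.ev n (G \<sigma>) * x * word.ev n (rev (G \<sigma>)))"
        using ev_scal_commute[OF Gn] by (simp add: sg_mult mult.assoc)
    qed
    then show ?case using scale A_scale by simp
  qed
  obtain y where y: "hom p y" "eqv n z y" using p(1) by (auto simp: homog_def)
  then have av_A: "av (K n z) \<in> A"
    using av_span hom_word_span eqv_wf K_eqv by metis
  have wz: "wf n z" using p(1) homog_wf by blast
  have "sg (odd (length (G \<sigma>)) \<and> p) (word.ev n (G \<sigma>) * K n z * word.ev n (rev (G \<sigma>))) = K n z"
    if s: "\<sigma> \<in> ?P" for \<sigma>
  proof -
    let ?g = "word.ev n (G \<sigma>)" and ?h = "word.ev n (rev (G \<sigma>))"
    have "K n z * ?g = sg (p \<and> odd (length (G \<sigma>))) (?g * K n z)"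
      using supercommute_hom[OF mn wz p(2) hom_word_term word_term_wf[OF G(1)[OF s]]]
      by (simp add: K_word_term[OF Gn[OF s]])
    then have "sg (odd (length (G \<sigma>)) \<and> p) (?g * K n z * ?h) = K n z * (?g * ?h)"
      by (simp add: sg_mult conj_commute flip: mult.assoc)
    \<comment> \<open>Relabelling fixes the empty word, so the reversed lift evaluates to the
      inverse.\<close>
    also have "?g * ?h = K n (Scal 1)"
      using G(2)[OF s, of "[]"] by (simp add: word.ev_e[OF Gn[OF s]] s)
    finally show ?thesis using wz by (simp add: K_one_r)
  qed
  then have "av (K n z) = (\<Sum>\<sigma>\<in>?P. K n z)" unfolding av_def by (intro sum.cong HOL.refl) auto
  moreover have "?P \<noteq> {}" using permutes_id by blast
  ultimately show ?thesis
    using sum_const_div[of ?P n "K n z"] av_A A_scale wz by (metis K_one_l finite_atLeastAtMost finite_permutations)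
qed

theorem mainTheorem17:
  fixes n :: nat
  assumes "n \<ge> 3"
  shows "SZ n (n - 2) = alg_gen n (SZ (n - 2) (n - 2) \<union> {pi n, pi (n - 1), Gen (n - 1)})"
proof -
  define m where "m = n - 2"
  have m: "1 \<le> m" "m < n" "m \<le> n" "n = Suc (Suc m)" "n - 1 = Suc m" using assms by (auto simp: m_def)
  let ?S = "SZ m m \<union> {pi n, pi (n - 1), Gen (n - 1)}"
  let ?B = "alg_gen n ?S"
  \<comment> \<open>\<open>n \<ge> 3\<close> gives \<open>2 \<le> n - 1\<close>, so
    \<open>pi (n - 1)\<close> has a summand and \<open>pi_in_sz_hom\<close> applies to it.\<close>
  have S_SZ: "s \<in> SZ n m" if "s \<in> ?S" for s
    using that SZ_mono[OF m(3)] pi_in_sz_hom[of n n m] pi_in_sz_hom[of "n - 1" n m]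
      Gen_in_sz_hom[of m "n - 1" n] assms m by (auto intro: SZ_sz_hom)
  have B_SZ: "x \<in> SZ n m" if "x \<in> ?B" for x
    using that
  proof (induction rule: alg_gen.induct)
    case (1 c)
    then show ?case using Scal_in_sz_hom m SZ_sz_hom by blast
  next
    case (5 x y)
    then show ?case using SZ_K K_eqv eqv_wf by blast
  qed (use S_SZ SZ_Add SZ_Mul m in auto)
  have B_wf: "wf n x" if "x \<in> ?B" for x using B_SZ that SZ_wf by blast
  \<comment> \<open>The argument runs in \<open>R\<close>; as \<open>alg_gen\<close> is closed under
    \<open>eqv n\<close>, \<open>K_B\<close> below leads back from \<open>A\<close> to
    terms.\<close>
  define A where "A = K n ` ?B"
  have A_K: "K n x \<in> A" if "x \<in> ?B" for x using that by (simp add: A_def)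
  have A_add: "x + y \<in> A" if "x \<in> A" "y \<in> A" for x y
    using that B_wf alg_gen.intros(3)[of _ n ?S] by (fastforce simp: A_def simp flip: K_add)
  have A_mult: "x * y \<in> A" if "x \<in> A" "y \<in> A" for x y
    using that B_wf alg_gen.intros(4)[of _ n ?S] by (fastforce simp: A_def simp flip: K_mul)
  have A_scale: "K n (Scal c) * x \<in> A" if "x \<in> A" for c x
    using that A_mult A_K alg_gen.intros(1) by blast
  have A_e: "K n (Scal 1) \<in> A" and A_0: "0 \<in> A"
    using A_K alg_gen.intros(1) K_zero by metis+
  have A_minus: "- x \<in> A" if x: "x \<in> A" for x
  proof -
    have "- x = K n (Scal (-1)) * x"
      using x B_wf by (auto simp: A_def K_minus_one K_one_l)
    then show ?thesis using A_scale x by simp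
  qed
  have gens_A: "K n (pi n) \<in> A" "K n (pi (n - 1)) \<in> A" "K n (Gen (n - 1)) \<in> A"
    by (auto intro!: A_K alg_gen.intros(2))
  have sets: "{1..<n - 1} = {1..m}" "{1..<n} = insert (n - 1) {1..m}" using m by auto
  have t_ab: "tK n (n - 1) n = K n (Gen (n - 1))" using gens.t_Suc[of n "Suc m"] m by simp
  have orbit: "word.orbit_sum n {1..m} w \<in> A" if w: "w \<in> words {1..n}" for w
  proof (rule word.orbit_sum_in_subalgebra[where a = "n - 1" and b = n])
    show "x \<in> A" if "finite S" "S \<noteq> {}" "K n (Scal 1) * x = x" "(\<Sum>i\<in>S. x) \<in> A"
      for S :: "(nat list \<times> nat list \<times> (nat \<Rightarrow> nat)) set" and x
      using sum_const_div[OF that(1-3)] A_scale that(4) by metis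
    show "(\<Sum>x\<in>{1..m}. tK n x (n - 1)) \<in> A"
      using gens_A(2) K_pi[of "n - 1" n] sets by simp
    \<comment> \<open>The last summand of \<open>pi n\<close>, of index \<open>n - 1\<close>, lies
      outside \<open>{1..m}\<close> and equals the generator \<open>Gen (n - 1)\<close>; the
      summands of \<open>pi (n - 1)\<close> already run over \<open>{1..m}\<close>.\<close>
    have "K n (pi n) = K n (Gen (n - 1)) + (\<Sum>x\<in>{1..m}. tK n x n)"
      using K_pi[of n n] m t_ab unfolding sets by simp
    then have "(\<Sum>x\<in>{1..m}. tK n x n) = K n (pi n) + - K n (Gen (n - 1))" by simp
    then show "(\<Sum>x\<in>{1..m}. tK n x n) \<in> A"
      using A_add[OF gens_A(1) A_minus[OF gens_A(3)]] by (simp only:)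
    show "word.orbit_sum n {1..m} v \<in> A" if "v \<in> words {1..m}" for v
      using orbit_sum_in_SZ[OF that] m A_K alg_gen.intros(2) by (metis UnI1)
  qed (use m w A_e A_add A_minus A_mult gens_A t_ab in auto)
  have K_B: "x \<in> ?B" if x: "wf n x" "K n x \<in> A" for x
  proof -
    obtain y where y: "y \<in> ?B" "K n x = K n y" using x(2) by (auto simp: A_def)
    then have "eqv n y x" using x(1) B_wf K_eq by metis
    with y(1) show ?thesis by (rule alg_gen.intros(5))
  qed
  have "x \<in> ?B" if "x \<in> SZ n m" for x
    using that
  proof (induction rule: SZ_induct)
    case zero
    show ?case by (rule alg_gen.intros(1))
  next
    case (base s)
    then have "K n s \<in> A" using sz_hom_in_subalgebra[OF m(3) A_add A_scale A_0 orbit] by blast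
    then show ?case using K_B base SZ_sz_hom SZ_wf by blast
  next
    case (add x y)
    show ?case using add.IH by (rule alg_gen.intros(3))
  next
    case (scale c x)
    show ?case using alg_gen.intros(1) scale.IH by (rule alg_gen.intros(4))
  next
    case (eqv x y)
    show ?case using eqv.IH eqv.hyps(2) by (rule alg_gen.intros(5))
  qed
  then have "SZ n m = ?B" using B_SZ by blast
  then show ?thesis by (simp add: m_def)
qed

end
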